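(* Let $n\ge2$ and let $G\subset\mathbb{R}^n$ be a John domain with $\operatorname{diam}(G)\le4$ such that $$\limsup_{k\to\infty}2^{-\lambda k}\,\sharp\mathcal{W}_k>0,$$ where $\lambda=\dim_{\mathcal{M}}(\partial G)$. Suppose that $$p\le\frac{q(n-\lambda b)}{q+b(n-\lambda)},\qquad b=\frac{2\beta}{1+\beta},$$ where $1\le q<p<\infty$ and $\beta\in(0,1]$. Then the $\beta$-version $G_\beta$ of $G$ does not satisfy the $(q,p)$-Poincaré inequality.
   Context: A domain is an open connected set. A bounded domain $D$ satisfies the $(q,p)$-Poincaré inequality if there is a finite constant $c$ such that $\left(\int_D|u-u_D|^q\,dx\right)^{1/q}\le c\left(\int_D|\nabla u|^p\,dx\right)^{1/p}$ for all $u$ in the Sobolev space $W^{1,p}(D)$, where $u_D$ is the integral average of $u$ over $D$. John domain: a bounded domain $G\subset\mathbb{R}^n$ is a John domain if there exist $x_0\in G$ and $c_J\in(0,1]$ such that every $x\in G$ can be joined to $x_0$ by a rectifiable curve $\gamma:[0,\ell(\gamma)]\to G$ parametrized by arc length with $\gamma(0)=x$, $\gamma(\ell(\gamma))=x_0$ and $\operatorname{dist}(\gamma(t),\partial G)\ge c_Jt$ for each $t\in[0,\ell(\gamma)]$. Upper Minkowski dimension of $E\subset\mathbb{R}^n$: $\dim_{\mathcal{M}}(E)=\sup\{\lambda\ge0:\limsup_{r\to0+}\mathcal{M}_\lambda(E,r)=\infty\}$, where $\mathcal{M}_\lambda(E,r)=\left|\bigcup_{x\in E}B^n(x,r)\right|/r^{n-\lambda}$.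 Whitney decomposition: for each domain $G$ a Whitney decomposition $\mathcal{W}=\mathcal{W}_G$ (as constructed in Stein's book) is fixed: a family of closed dyadic cubes with pairwise disjoint interiors and union $G$, such that $\operatorname{diam}(Q)\le\operatorname{dist}(Q,\partial G)\le4\operatorname{diam}(Q)$ for each $Q\in\mathcal{W}$, and $\sum_{Q\in\mathcal{W}}\chi_{Q^*}\le12^n$ with $Q^*=\frac98Q$. $\mathcal{W}_k$ is the family of cubes in $\mathcal{W}$ with side length $2^{-k}$ and $\sharp\mathcal{W}_k$ is their number. $\beta$-version: let $\beta\in(0,1]$ and let $Q=\prod_{i=1}^n[x_i-\ell/2,x_i+\ell/2]$ be a closed cube with side length $\ell\le4$. Put - room: $R(Q)=\prod_{i=1}^n(x_i-\ell/8,x_i+\ell/8)$; - $\beta$-passage: $P_\beta(Q)=\Big(\prod_{i=1}^{n-1}(x_i-(\ell/8)^{1/\beta},x_i+(\ell/8)^{1/\beta})\Big)\times(x_n+\ell/8,\,x_n+\ell/8+(\ell/8)^{1/\beta})$; - long $\beta$-passage: $L_\beta(Q)=\Big(\prod_{i=1}^{n-1}(x_i-(\ell/8)^{1/\beta},x_i+(\ell/8)^{1/\beta})\Big)\times(x_n,x_n+\ell/2)$; - $\beta$-apartment: $A_\beta(Q)=L_\beta(Q)\cup\big(Q\setminus(\partial R(Q)\cup\partial P_\beta(Q))\big)$. The $\beta$-version of a John domain $G$ (with $\operatorname{diam}(G)\le4$) is the domain $G_\beta=\bigcup_{Q\in\mathcal{W}_G}A_\beta(Q)$. *)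

theory Defs
  imports "HOL-Analysis.Analysis"
begin

definition domain :: "'a::topological_space set \<Rightarrow> bool"
  where "domain D \<longleftrightarrow> open D \<and> connected D"

subsection \<open>Sobolev functions and the Poincare inequality\<close>

definition partial_deriv :: "'n::finite \<Rightarrow> (real^'n \<Rightarrow> real) \<Rightarrow> real^'n \<Rightarrow> real"
  where "partial_deriv i f x = frechet_derivative f (at x) (axis i 1)"

primrec Ck :: "nat \<Rightarrow> (real^'n::finite \<Rightarrow> real) \<Rightarrow> bool"
  where
    "Ck 0 f \<longleftrightarrow> continuous_on UNIV f"
  | "Ck (Suc k) f \<longleftrightarrow> (\<forall>x. f differentiable (at x)) \<and> (\<forall>i. Ck k (partial_deriv i f))"

definition test_function :: "(real^'n::finite) set \<Rightarrow> (real^'n \<Rightarrow> real) \<Rightarrow> bool"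
  where "test_function D \<phi> \<longleftrightarrow>
    (\<forall>k. Ck k \<phi>) \<and> compact (closure {x. \<phi> x \<noteq> 0}) \<and> closure {x. \<phi> x \<noteq> 0} \<subseteq> D"

definition in_Lp :: "real \<Rightarrow> (real^'n::finite) set \<Rightarrow> (real^'n \<Rightarrow> 'b::euclidean_space) \<Rightarrow> bool"
  where "in_Lp p D f \<longleftrightarrow>
    f \<in> borel_measurable (lebesgue_on D) \<and> integrable (lebesgue_on D) (\<lambda>x. norm (f x) powr p)"

definition Lp_norm :: "real \<Rightarrow> (real^'n::finite) set \<Rightarrow> (real^'n \<Rightarrow> 'b::euclidean_space) \<Rightarrow> real"
  where "Lp_norm p D f = (integral\<^sup>L (lebesgue_on D) (\<lambda>x. norm (f x) powr p)) powr (1 / p)"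

definition weak_gradient ::
    "(real^'n::finite) set \<Rightarrow> (real^'n \<Rightarrow> real) \<Rightarrow> (real^'n \<Rightarrow> real^'n) \<Rightarrow> bool"
  where "weak_gradient D u g \<longleftrightarrow>
    (\<forall>\<phi> i. test_function D \<phi> \<longrightarrow>
      integral\<^sup>L (lebesgue_on D) (\<lambda>x. u x * partial_deriv i \<phi> x) =
      - integral\<^sup>L (lebesgue_on D) (\<lambda>x. g x $ i * \<phi> x))"

text \<open>\<open>u\<close> belongs to \<open>W\<^sup>1\<^sup>,\<^sup>p(D)\<close> with weak gradient \<open>g\<close>.\<close>

definition sobolev_W1p ::
    "real \<Rightarrow> (real^'n::finite) set \<Rightarrow> (real^'n \<Rightarrow> real) \<Rightarrow> (real^'n \<Rightarrow> real^'n) \<Rightarrow> bool"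
  where "sobolev_W1p p D u g \<longleftrightarrow> in_Lp p D u \<and> in_Lp p D g \<and> weak_gradient D u g"

definition average :: "(real^'n::finite) set \<Rightarrow> (real^'n \<Rightarrow> real) \<Rightarrow> real"
  where "average D u = integral\<^sup>L (lebesgue_on D) u / measure lebesgue D"

text \<open>The Bochner integral of a non-integrable function is \<open>0\<close>. As the right-hand side below is
  finite, finiteness of the left-hand side is part of the inequality and is required explicitly.\<close>

definition poincare :: "real \<Rightarrow> real \<Rightarrow> (real^'n::finite) set \<Rightarrow> bool"
  where "poincare q p D \<longleftrightarrow>
    (\<exists>c. \<forall>u g. sobolev_W1p p D u g \<longrightarrow>
      in_Lp q D (\<lambda>x. u x - average D u) \<and>
      Lp_norm q D (\<lambda>x. u x - average D u) \<le> c * Lp_norm p D g)"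

subsection \<open>John domains\<close>

definition curve_length :: "(real \<Rightarrow> 'a::metric_space) \<Rightarrow> real \<Rightarrow> real \<Rightarrow> ennreal"
  where "curve_length \<gamma> a b =
    Sup {ennreal (\<Sum>i<m. dist (\<gamma> (t i)) (\<gamma> (t (Suc i)))) | (m::nat) t.
           t 0 = a \<and> t m = b \<and> (\<forall>i<m. t i \<le> t (Suc i))}"

definition arc_length_curve :: "real \<Rightarrow> (real \<Rightarrow> 'a::metric_space) \<Rightarrow> bool"
  where "arc_length_curve L \<gamma> \<longleftrightarrow>
    0 \<le> L \<and> continuous_on {0..L} \<gamma> \<and> (\<forall>t\<in>{0..L}. curve_length \<gamma> 0 t = ennreal t)"

definition john_domain :: "(real^'n::finite) set \<Rightarrow> bool"
  where "john_domain G \<longleftrightarrow>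
    domain G \<and> bounded G \<and>
    (\<exists>x0\<in>G. \<exists>c. 0 < c \<and> c \<le> 1 \<and>
      (\<forall>x\<in>G. \<exists>L \<gamma>. arc_length_curve L \<gamma> \<and> \<gamma> ` {0..L} \<subseteq> G \<and> \<gamma> 0 = x \<and> \<gamma> L = x0 \<and>
        (\<forall>t\<in>{0..L}. c * t \<le> infdist (\<gamma> t) (frontier G))))"

subsection \<open>Upper Minkowski dimension\<close>

definition minkowski_content :: "real \<Rightarrow> (real^'n::finite) set \<Rightarrow> real \<Rightarrow> ennreal"
  where "minkowski_content s E r =
    emeasure lebesgue (\<Union>x\<in>E. ball x r) / ennreal (r powr (real CARD('n) - s))"

definition upper_minkowski_dim :: "(real^'n::finite) set \<Rightarrow> ennreal"
  where "upper_minkowski_dim E =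
    Sup {ennreal s | s. 0 \<le> s \<and> Limsup (at_right 0) (minkowski_content s E) = \<infinity>}"

subsection \<open>Whitney decompositions\<close>

definition cube :: "real^'n::finite \<Rightarrow> real \<Rightarrow> (real^'n) set"
  where "cube x l = {y. \<forall>i. x $ i - l / 2 \<le> y $ i \<and> y $ i \<le> x $ i + l / 2}"

definition dyadic_cube :: "(real^'n::finite) set \<Rightarrow> bool"
  where "dyadic_cube Q \<longleftrightarrow>
    (\<exists>(j::int) (z :: int^'n).
      Q = {y. \<forall>i. 2 powi j * of_int (z $ i) \<le> y $ i \<and> y $ i \<le> 2 powi j * (of_int (z $ i) + 1)})"

text \<open>The last clause says that the concentric cubes \<open>Q\<^sup>* = (9/8) Q\<close> have overlap at most
  \<open>12\<^sup>n\<close>.\<close>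

definition whitney :: "(real^'n::finite) set \<Rightarrow> (real^'n) set set \<Rightarrow> bool"
  where "whitney G W \<longleftrightarrow>
    (\<forall>Q\<in>W. dyadic_cube Q) \<and>
    pairwise (\<lambda>Q Q'. interior Q \<inter> interior Q' = {}) W \<and>
    \<Union>W = G \<and>
    (\<forall>Q\<in>W. diameter Q \<le> setdist Q (frontier G) \<and> setdist Q (frontier G) \<le> 4 * diameter Q) \<and>
    (\<forall>y. let S = {Q \<in> W. \<exists>x l. 0 < l \<and> Q = cube x l \<and> y \<in> cube x (9 / 8 * l)}
         in finite S \<and> card S \<le> 12 ^ CARD('n))"

definition whitney_layer :: "(real^'n::finite) set set \<Rightarrow> nat \<Rightarrow> (real^'n) set set"
  where "whitney_layer W k = {Q \<in> W. \<exists>x. Q = cube x (1 / 2 ^ k)}"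

subsection \<open>The beta-version of a domain\<close>

text \<open>The sets below are attached to the cube with centre \<open>x\<close> and side length \<open>l\<close>. The index \<open>m\<close>
  is the coordinate called \<open>n\<close> (the last one) in the informal definition; the type of indices
  carries no order, so it is a parameter.\<close>

definition room :: "real^'n::finite \<Rightarrow> real \<Rightarrow> (real^'n) set"
  where "room x l = {y. \<forall>i. x $ i - l / 8 < y $ i \<and> y $ i < x $ i + l / 8}"

definition passage :: "'n \<Rightarrow> real \<Rightarrow> real^'n::finite \<Rightarrow> real \<Rightarrow> (real^'n) set"
  where "passage m \<beta> x l =
    {y. (\<forall>i. i \<noteq> m \<longrightarrow>
           x $ i - (l / 8) powr (1 / \<beta>) < y $ i \<and> y $ i < x $ i + (l / 8) powr (1 / \<beta>)) \<and>
        x $ m + l / 8 < y $ m \<and> y $ m < x $ m + l / 8 + (l / 8) powr (1 / \<beta>)}"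

definition long_passage :: "'n \<Rightarrow> real \<Rightarrow> real^'n::finite \<Rightarrow> real \<Rightarrow> (real^'n) set"
  where "long_passage m \<beta> x l =
    {y. (\<forall>i. i \<noteq> m \<longrightarrow>
           x $ i - (l / 8) powr (1 / \<beta>) < y $ i \<and> y $ i < x $ i + (l / 8) powr (1 / \<beta>)) \<and>
        x $ m < y $ m \<and> y $ m < x $ m + l / 2}"

definition apartment :: "'n \<Rightarrow> real \<Rightarrow> real^'n::finite \<Rightarrow> real \<Rightarrow> (real^'n) set"
  where "apartment m \<beta> x l =
    long_passage m \<beta> x l \<union> (cube x l - (frontier (room x l) \<union> frontier (passage m \<beta> x l)))"

definition beta_version :: "'n \<Rightarrow> real \<Rightarrow> (real^'n::finite) set set \<Rightarrow> (real^'n) set"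
  where "beta_version m \<beta> W = \<Union>{apartment m \<beta> x l | x l. 0 < l \<and> cube x l \<in> W}"

end

theory Submission
  imports Defs
begin

text \<open>
  For a single layer of Whitney cubes of side \<open>l = 2\<^sup>-\<^sup>k\<close>, let \<open>u\<close> be \<open>1\<close> on the rooms, decrease
  linearly to \<open>0\<close> along the passages, whose width and height are comparable to
  \<open>h = (l/8)\<^sup>1\<^sup>/\<^sup>\<beta>\<close>, and vanish elsewhere. With \<open>N\<close> cubes in the layer, the distance of \<open>u\<close> from the
  constants in \<open>L\<^sup>q\<close> is at least a constant times \<open>(N l\<^sup>n)\<^sup>1\<^sup>/\<^sup>q\<close>, because \<open>u\<close> is \<open>1\<close> on the rooms and \<open>0\<close>
  near a corner of each cube, and \<open>\<parallel>\<nabla>u\<parallel>\<^sub>p\<close> is at most a constant times \<open>(N h\<^sup>n\<^sup>-\<^sup>p)\<^sup>1\<^sup>/\<^sup>p\<close>. So the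
  inequality bounds \<open>N\<^sup>1\<^sup>/\<^sup>q\<^sup>-\<^sup>1\<^sup>/\<^sup>p\<close> by a power of \<open>l\<close>. Since \<open>N\<close> is at least a constant times \<open>l\<^sup>-\<^sup>\<lambda>\<close>
  for infinitely many \<open>k\<close>, this excludes the inequality for \<open>p < q (n - \<lambda>\<beta>) / (q + \<beta> (n - \<lambda>))\<close>, which
  the hypothesis on \<open>p\<close> implies. That \<open>\<lambda> \<le> n\<close> follows in the same way from the volume bound
  \<open>N l\<^sup>n \<le> |G|\<close>.
\<close>

section \<open>Locally Lipschitz functions\<close>

definition locally_lipschitz_at :: "('a::metric_space \<Rightarrow> 'b::metric_space) \<Rightarrow> 'a \<Rightarrow> bool"
  where "locally_lipschitz_at f x \<longleftrightarrow> (\<exists>r>0. \<exists>L. L-lipschitz_on (ball x r) f)"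

lemma locally_lipschitz_atI:
  assumes "L-lipschitz_on S f" "open S" "x \<in> S"
  shows "locally_lipschitz_at f x"
proof -
  obtain r where "r > 0" "ball x r \<subseteq> S"
    using assms(2,3) open_contains_ball by blast
  with assms(1) show ?thesis
    unfolding locally_lipschitz_at_def using lipschitz_on_subset by blast
qed

lemma locally_lipschitz_at_imp_isCont:
  assumes "locally_lipschitz_at f x"
  shows "isCont f x"
proof -
  obtain r L where "r > 0" "L-lipschitz_on (ball x r) f"
    using assms unfolding locally_lipschitz_at_def by blast
  then show ?thesis
    using lipschitz_on_continuous_on continuous_on_eq_continuous_at[of "ball x r" f] by auto
qed

lemma locally_lipschitz_at_common_ball:
  assumes "locally_lipschitz_at f x" "locally_lipschitz_at g x"
  obtains r L M where "r > 0" "L-lipschitz_on (ball x r) f" "M-lipschitz_on (ball x r) g"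
proof -
  obtain r s L M where "r > 0" "L-lipschitz_on (ball x r) f" "s > 0" "M-lipschitz_on (ball x s) g"
    using assms unfolding locally_lipschitz_at_def by blast
  then show ?thesis
    by (intro that[of "min r s" L M]) (auto intro: lipschitz_on_subset)
qed

lemma locally_lipschitz_at_add:
  fixes f g :: "'a::metric_space \<Rightarrow> 'b::real_normed_vector"
  assumes "locally_lipschitz_at f x" "locally_lipschitz_at g x"
  shows "locally_lipschitz_at (\<lambda>y. f y + g y) x"
proof -
  obtain r L M where "r > 0" "L-lipschitz_on (ball x r) f" "M-lipschitz_on (ball x r) g"
    using assms by (rule locally_lipschitz_at_common_ball)
  then show ?thesis
    unfolding locally_lipschitz_at_def using lipschitz_on_add by blast
qed

lemma locally_lipschitz_at_sum:
  fixes f :: "'i \<Rightarrow> 'a::metric_space \<Rightarrow> 'b::real_normed_vector"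
  assumes "\<And>i. i \<in> I \<Longrightarrow> locally_lipschitz_at (f i) x"
  shows "locally_lipschitz_at (\<lambda>y. \<Sum>i\<in>I. f i y) x"
  using assms
proof (induction I rule: infinite_finite_induct)
  case (insert i I)
  then show ?case
    by (simp add: locally_lipschitz_at_add)
qed (auto intro: locally_lipschitz_atI[OF lipschitz_on_constant open_UNIV])

lemma lipschitz_on_bounded_image:
  assumes "L-lipschitz_on X f" "bounded X"
  shows "bounded (f ` X)"
proof (cases "X = {}")
  case False
  then obtain a where a: "a \<in> X"
    by blast
  obtain B where "\<And>x. x \<in> X \<Longrightarrow> dist a x \<le> B"
    using assms(2) bounded_any_center[of X a] by blast
  then have "dist (f a) (f x) \<le> L * B" if "x \<in> X" for x
    using that lipschitz_onD[OF assms(1) a that] lipschitz_on_nonneg[OF assms(1)]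
    by (meson mult_left_mono order_trans)
  then show ?thesis
    unfolding bounded_def by blast
qed simp

lemma lipschitz_on_mult_bounded:
  fixes f g :: "'a::metric_space \<Rightarrow> 'b::real_normed_algebra"
  assumes f: "L-lipschitz_on X f" and g: "M-lipschitz_on X g"
    and f_bound: "\<And>x. x \<in> X \<Longrightarrow> norm (f x) \<le> A" and g_bound: "\<And>x. x \<in> X \<Longrightarrow> norm (g x) \<le> B"
    and "0 \<le> A" "0 \<le> B"
  shows "(A * M + L * B)-lipschitz_on X (\<lambda>x. f x * g x)"
proof (rule lipschitz_onI)
  fix x y assume xy: "x \<in> X" "y \<in> X"
  have "dist (f x * g x) (f y * g y) = norm (f x * (g x - g y) + (f x - f y) * g y)"
    by (simp add: dist_norm algebra_simps)
  also have "\<dots> \<le> norm (f x) * norm (g x - g y) + norm (f x - f y) * norm (g y)"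
    by (intro norm_triangle_le add_mono norm_mult_ineq)
  also have "\<dots> \<le> A * (M * dist x y) + L * dist x y * B"
    using lipschitz_onD[OF f xy] lipschitz_onD[OF g xy] xy \<open>0 \<le> A\<close> lipschitz_on_nonneg[OF f]
    by (intro add_mono mult_mono f_bound g_bound) (auto simp: dist_norm)
  finally show "dist (f x * g x) (f y * g y) \<le> (A * M + L * B) * dist x y"
    by (simp add: algebra_simps)
qed (use lipschitz_on_nonneg[OF f] lipschitz_on_nonneg[OF g] assms in simp)

lemma locally_lipschitz_at_mult:
  fixes f g :: "'a::metric_space \<Rightarrow> 'b::real_normed_algebra"
  assumes "locally_lipschitz_at f x" "locally_lipschitz_at g x"
  shows "locally_lipschitz_at (\<lambda>y. f y * g y) x"
proof -
  obtain r L M where r: "r > 0"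
    and f: "L-lipschitz_on (ball x r) f" and g: "M-lipschitz_on (ball x r) g"
    using assms by (rule locally_lipschitz_at_common_ball)
  obtain A B where "A > 0" "\<And>y. y \<in> ball x r \<Longrightarrow> norm (f y) \<le> A"
    and "B > 0" "\<And>y. y \<in> ball x r \<Longrightarrow> norm (g y) \<le> B"
    using lipschitz_on_bounded_image[OF f] lipschitz_on_bounded_image[OF g]
    by (auto simp: bounded_pos)
  then have "(A * M + L * B)-lipschitz_on (ball x r) (\<lambda>y. f y * g y)"
    by (intro lipschitz_on_mult_bounded[OF f g]) auto
  with r show ?thesis
    unfolding locally_lipschitz_at_def by blast
qed

lemma continuous_gradient_imp_locally_lipschitz_at:
  fixes f :: "'a::euclidean_space \<Rightarrow> real"
  assumes f: "\<And>y. (f has_derivative (\<lambda>h. g y \<bullet> h)) (at y)" and g: "continuous_on UNIV g"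
  shows "locally_lipschitz_at f x"
proof -
  have "bounded (g ` cball x 1)"
    using g
    by (intro compact_imp_bounded compact_continuous_image) (auto intro: continuous_on_subset)
  then obtain B where B: "B > 0" "\<And>y. y \<in> cball x 1 \<Longrightarrow> norm (g y) \<le> B"
    by (auto simp: bounded_pos)
  have "B-lipschitz_on (ball x 1) f"
  proof (rule bounded_derivative_imp_lipschitz)
    show "(f has_derivative (\<lambda>h. g y \<bullet> h)) (at y within ball x 1)" for y
      using f by (rule has_derivative_at_withinI)
    show "onorm (\<lambda>h. g y \<bullet> h) \<le> B" if "y \<in> ball x 1" for y
    proof (rule onorm_le)
      fix h
      have "norm (g y \<bullet> h) \<le> norm (g y) * norm h"
        using Cauchy_Schwarz_ineq2[of "g y" h] by simp
      also have "\<dots> \<le> B * norm h"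
        using B(2)[of y] that by (intro mult_right_mono) auto
      finally show "norm (g y \<bullet> h) \<le> B * norm h" .
    qed
  qed (use B(1) in auto)
  then show ?thesis
    by (rule locally_lipschitz_atI) auto
qed

lemma locally_lipschitz_on_compact_imp_lipschitz_on:
  assumes "compact X" "\<And>x. x \<in> X \<Longrightarrow> locally_lipschitz_at f x"
  obtains L where "L-lipschitz_on X f"
proof -
  have "local_lipschitz {0::real} X (\<lambda>_. f)"
  proof (rule local_lipschitzI)
    fix x and t :: real assume "x \<in> X"
    then obtain r L where r: "r > 0" "L-lipschitz_on (ball x r) f"
      using assms(2) unfolding locally_lipschitz_at_def by blast
    have "L-lipschitz_on (cball x (r / 2) \<inter> X) f"
      by (rule lipschitz_on_subset[OF r(2)]) (use r(1) in auto)
    with r(1) show "\<exists>u>0. \<exists>L. \<forall>t\<in>cball t u \<inter> {0}. L-lipschitz_on (cball x u \<inter> X) f"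
      by (intro exI[of _ "r / 2"]) auto
  qed
  then obtain L where "\<And>t::real. t \<in> {0} \<Longrightarrow> L-lipschitz_on X f"
    by (rule local_lipschitz_compact_implies_lipschitz) (use assms(1) in auto)
  with that show ?thesis
    by blast
qed

lemma locally_lipschitz_bounded_support_imp_lipschitz:
  fixes v :: "'a::euclidean_space \<Rightarrow> 'b::real_normed_vector"
  assumes "\<And>x. locally_lipschitz_at v x" and "bounded K" and supp: "\<And>x. x \<notin> K \<Longrightarrow> v x = 0"
  obtains L where "L-lipschitz_on UNIV v"
proof -
  obtain R where R: "R > 0" "K \<subseteq> ball 0 R"
    using \<open>bounded K\<close> bounded_subset_ballD by blast
  define X :: "'a set" where "X = cball 0 R"
  have X: "convex X" "closed X" "X \<noteq> {}" "compact X"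
    using R(1) by (auto simp: X_def)
  obtain L where L: "L-lipschitz_on X v"
    using locally_lipschitz_on_compact_imp_lipschitz_on[OF X(4) assms(1)] .
  \<comment> \<open>The function vanishes outside the open ball, so composing it with the nearest point
    projection onto the closed ball, which does not increase distances, does not change it.\<close>
  have proj: "v (closest_point X y) = v y" for y
  proof (cases "y \<in> X")
    case False
    then have "y \<in> affine hull X - rel_interior X"
      using R(1) by (simp add: X_def rel_interior_nonempty_interior affine_hull_nonempty_interior)
    then have "closest_point X y \<in> sphere 0 R"
      using closest_point_in_rel_frontier[OF X(2,3), of y] R(1)
      by (simp add: X_def rel_frontier_cball)
    then have "closest_point X y \<notin> K" "y \<notin> K"
      using R(2) False by (auto simp: X_def)
    then show ?thesis
      by (simp add: supp)
  qed (simp add: closest_point_self)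
  have "L-lipschitz_on UNIV v"
  proof (rule lipschitz_onI)
    fix x y
    have "dist (v x) (v y) \<le> L * dist (closest_point X x) (closest_point X y)"
      using lipschitz_onD[OF L, of "closest_point X x" "closest_point X y"] closest_point_in_set[OF X(2,3)]
      by (simp add: proj)
    also have "\<dots> \<le> L * dist x y"
      using lipschitz_on_nonneg[OF L] X by (intro mult_left_mono closest_point_lipschitz) auto
    finally show "dist (v x) (v y) \<le> L * dist x y" .
  qed (rule lipschitz_on_nonneg[OF L])
  with that show ?thesis .
qed

section \<open>Weak gradients of locally Lipschitz functions\<close>

lemma lebesgue_integral_translate:
  fixes v :: "'a::euclidean_space \<Rightarrow> 'b::euclidean_space"
  assumes [measurable]: "v \<in> borel_measurable borel"
  shows "integral\<^sup>L lebesgue (\<lambda>x. v (x + a)) = integral\<^sup>L lebesgue v"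
    and "integrable lebesgue (\<lambda>x. v (x + a)) \<longleftrightarrow> integrable lebesgue v"
proof -
  have "integral\<^sup>L lborel (\<lambda>x. v (a + x)) = integral\<^sup>L (distr lborel borel ((+) a)) v"
    by (intro integral_distr[symmetric]) auto
  moreover have "integrable lborel (\<lambda>x. v (a + x)) = integrable (distr lborel borel ((+) a)) v"
    by (intro integrable_distr_eq[symmetric]) auto
  ultimately show "integral\<^sup>L lebesgue (\<lambda>x. v (x + a)) = integral\<^sup>L lebesgue v"
    and "integrable lebesgue (\<lambda>x. v (x + a)) \<longleftrightarrow> integrable lebesgue v"
    by (simp_all add: lborel_distr_plus integral_completion integrable_completion add.commute)
qed

lemma borel_measurable_lebesgue_AE_LIMSEQ:
  fixes f :: "nat \<Rightarrow> 'a::euclidean_space \<Rightarrow> 'b::euclidean_space"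
  assumes "\<And>j. f j \<in> borel_measurable lebesgue" "AE x in lebesgue. (\<lambda>j. f j x) \<longlonglongrightarrow> g x"
  shows "g \<in> borel_measurable lebesgue"
proof (rule borel_measurable_AE)
  show "(\<lambda>x. lim (\<lambda>j. f j x)) \<in> borel_measurable lebesgue"
    using assms(1) by (rule borel_measurable_lim_metric)
  show "AE x in lebesgue. lim (\<lambda>j. f j x) = g x"
    using assms(2) by eventually_elim (rule limI)
qed

lemma integrable_lebesgue_compact_support:
  fixes f :: "'a::euclidean_space \<Rightarrow> real"
  assumes "compact K" "continuous_on K f" "\<And>x. x \<notin> K \<Longrightarrow> f x = 0"
  shows "integrable lebesgue f"
proof -
  have "(\<lambda>x. indicator K x *\<^sub>R f x) = f"
    using assms(3) by (auto simp: indicator_def fun_eq_iff)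
  then have "integrable lborel f"
    using borel_integrable_compact[OF assms(1,2)] by simp
  then show ?thesis
    using integrable_completion[OF borel_measurable_integrable] by blast
qed

lemma has_derivative_along_line:
  fixes f :: "'a::real_normed_vector \<Rightarrow> real"
  assumes "(f has_derivative f') (at x)"
  shows "((\<lambda>t. f (x + t *\<^sub>R e)) has_real_derivative f' e) (at 0)"
proof -
  interpret bounded_linear f'
    using assms by (rule has_derivative_bounded_linear)
  have "((\<lambda>t. x + t *\<^sub>R e) has_derivative (\<lambda>t. t *\<^sub>R e)) (at 0)"
    by (auto intro!: derivative_eq_intros)
  moreover have "(f has_derivative f') (at (x + 0 *\<^sub>R e))"
    using assms by simp
  ultimately have "((\<lambda>t. f (x + t *\<^sub>R e)) has_derivative (\<lambda>t. f' (t *\<^sub>R e))) (at 0)"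
    by (rule has_derivative_compose)
  then show ?thesis
    by (simp add: has_field_derivative_def scaleR mult_commute_abs)
qed

lemma has_real_derivative_imp_difference_quotients_LIMSEQ:
  assumes "(f has_real_derivative D) (at x)"
  shows "(\<lambda>j. real (Suc j) * (f (x + 1 / real (Suc j)) - f x)) \<longlonglongrightarrow> D"
proof -
  have "((\<lambda>t. (f (x + t) - f x) / t) \<longlongrightarrow> D) (at 0)"
    using assms by (simp add: DERIV_def)
  moreover have "filterlim (\<lambda>j. 1 / real (Suc j)) (at 0) sequentially"
    unfolding filterlim_at using lim_1_over_n[THEN LIMSEQ_Suc] by auto
  ultimately have "(\<lambda>j. (f (x + 1 / real (Suc j)) - f x) / (1 / real (Suc j))) \<longlonglongrightarrow> D"
    by (rule filterlim_compose)
  then show ?thesis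
    by (simp add: mult.commute)
qed

lemma lipschitz_difference_quotient_le_indicator:
  fixes v :: "'a::real_normed_vector \<Rightarrow> real"
  assumes v: "L-lipschitz_on UNIV v" and supp: "\<And>x. x \<notin> cball 0 R \<Longrightarrow> v x = 0" and "1 \<le> r"
  shows "\<bar>r * (v (x + (1 / r) *\<^sub>R e) - v x)\<bar> \<le> L * norm e * indicator (cball 0 (R + norm e)) x"
proof (cases "x \<in> cball 0 (R + norm e)")
  case True
  have "\<bar>v (x + (1 / r) *\<^sub>R e) - v x\<bar> \<le> L * norm ((1 / r) *\<^sub>R e)"
    using lipschitz_onD[OF v, of "x + (1 / r) *\<^sub>R e" x] by (simp add: dist_norm)
  then have "r * \<bar>v (x + (1 / r) *\<^sub>R e) - v x\<bar> \<le> r * (L * norm ((1 / r) *\<^sub>R e))"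
    using \<open>1 \<le> r\<close> by (intro mult_left_mono) auto
  also have "\<dots> = L * norm e"
    using \<open>1 \<le> r\<close> by simp
  finally show ?thesis
    using True \<open>1 \<le> r\<close> by (simp add: abs_mult)
next
  case False
  then have far: "R + norm e < norm x"
    by simp
  have "norm ((1 / r) *\<^sub>R e) \<le> norm e"
    using \<open>1 \<le> r\<close> by (simp add: divide_le_eq mult_le_cancel_left1)
  then have "R < norm (x + (1 / r) *\<^sub>R e)"
    using far norm_triangle_ineq2[of x "- ((1 / r) *\<^sub>R e)"] by simp
  moreover have "R < norm x"
    using far norm_ge_zero[of e] by linarith
  ultimately show ?thesis
    using False by (simp add: supp)
qed

text \<open>The integrals of the difference quotients vanish by translation invariance, and these
  quotients converge dominatedly.\<close>

lemma integral_directional_derivative_eq_0: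
  fixes v F :: "'a::euclidean_space \<Rightarrow> real"
  assumes v: "L-lipschitz_on UNIV v" and "bounded K" and supp: "\<And>x. x \<notin> K \<Longrightarrow> v x = 0"
    and der: "AE x in lebesgue. ((\<lambda>t. v (x + t *\<^sub>R e)) has_real_derivative F x) (at 0)"
  shows "integrable lebesgue F" and "integral\<^sup>L lebesgue F = 0"
proof -
  define d where "d = (\<lambda>j x. real (Suc j) * (v (x + (1 / real (Suc j)) *\<^sub>R e) - v x))"
  obtain R where "K \<subseteq> cball 0 R"
    using \<open>bounded K\<close> bounded_subset_ballD ball_subset_cball by (metis subset_trans)
  then have vanish: "v x = 0" if "x \<notin> cball 0 R" for x
    using that supp by blast
  have cont: "continuous_on X v" for X
    using lipschitz_on_continuous_on[OF v] continuous_on_subset by blast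
  then have [measurable]: "v \<in> borel_measurable borel"
    by (simp add: borel_measurable_continuous_onI)
  have "integrable lebesgue v"
    using vanish by (rule integrable_lebesgue_compact_support[OF compact_cball cont])
  then have d: "integral\<^sup>L lebesgue (d j) = 0" "d j \<in> borel_measurable lebesgue" for j
    using lebesgue_integral_translate[of v "(1 / real (Suc j)) *\<^sub>R e"]
    by (auto simp: d_def intro: measurable_completion)
  have dominated: "norm (d j x) \<le> L * norm e * indicator (cball 0 (R + norm e)) x" for j x
    using lipschitz_difference_quotient_le_indicator[OF v vanish, where r = "real (Suc j)"]
    by (simp add: d_def)
  have lim: "AE x in lebesgue. (\<lambda>j. d j x) \<longlonglongrightarrow> F x"
    using der
  proof eventually_elim
    case (elim x)
    then show ?case
      using has_real_derivative_imp_difference_quotients_LIMSEQ by (fastforce simp: d_def)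
  qed
  have F: "F \<in> borel_measurable lebesgue"
    using d(2) lim by (rule borel_measurable_lebesgue_AE_LIMSEQ)
  have dominating: "integrable lebesgue (\<lambda>x::'a. L * norm e * indicator (cball 0 (R + norm e)) x)"
    using lmeasurable_cball[of "0::'a" "R + norm e"]
    by (intro integrable_mult_right) (auto simp: fmeasurable_def)
  show "integrable lebesgue F"
    by (rule integrable_dominated_convergence[OF F d(2) dominating lim AE_I2[OF dominated]])
  have "(\<lambda>j. integral\<^sup>L lebesgue (d j)) \<longlonglongrightarrow> integral\<^sup>L lebesgue F"
    by (rule integral_dominated_convergence[OF F d(2) dominating lim AE_I2[OF dominated]])
  then show "integral\<^sup>L lebesgue F = 0"
    by (simp add: d(1) LIMSEQ_const_iff)
qed

definition gradient :: "(real^'n::finite \<Rightarrow> real) \<Rightarrow> real^'n \<Rightarrow> real^'n"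
  where "gradient f x = (\<chi> i. partial_deriv i f x)"

lemma gradient_eqI:
  fixes f :: "real^'n::finite \<Rightarrow> real"
  assumes "(f has_derivative (\<lambda>h. d \<bullet> h)) (at x)"
  shows "gradient f x = d"
  using frechet_derivative_at[OF assms, symmetric]
  by (simp add: gradient_def partial_deriv_def vec_eq_iff inner_axis)

lemma differentiable_imp_has_derivative_gradient:
  fixes f :: "real^'n::finite \<Rightarrow> real"
  assumes "f differentiable (at x)"
  shows "(f has_derivative (\<lambda>h. gradient f x \<bullet> h)) (at x)"
proof -
  have f': "(f has_derivative frechet_derivative f (at x)) (at x)"
    using assms frechet_derivative_works by blast
  then interpret bounded_linear "frechet_derivative f (at x)"
    by (rule has_derivative_bounded_linear)
  have "frechet_derivative f (at x) = (\<lambda>h. gradient f x \<bullet> h)"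
  proof
    fix h
    have "frechet_derivative f (at x) h = frechet_derivative f (at x) (\<Sum>i\<in>UNIV. (h $ i) *\<^sub>R axis i 1)"
      using basis_expansion[of h] by (simp add: scalar_mult_eq_scaleR)
    also have "\<dots> = (\<Sum>i\<in>UNIV. h $ i * partial_deriv i f x)"
      by (simp add: sum scaleR partial_deriv_def)
    also have "\<dots> = gradient f x \<bullet> h"
      by (simp add: gradient_def inner_vec_def mult.commute)
    finally show "frechet_derivative f (at x) h = gradient f x \<bullet> h" .
  qed
  with f' show ?thesis
    by simp
qed

lemma test_function_has_derivative_gradient:
  assumes "test_function D \<phi>"
  shows "(\<phi> has_derivative (\<lambda>h. gradient \<phi> x \<bullet> h)) (at x)"
proof (rule differentiable_imp_has_derivative_gradient)
  have "Ck (Suc 0) \<phi>"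
    using assms unfolding test_function_def by blast
  then show "\<phi> differentiable (at x)"
    by simp
qed

lemma test_function_continuous_gradient:
  assumes "test_function D \<phi>"
  shows "continuous_on X (gradient \<phi>)"
proof -
  have "Ck (Suc 0) \<phi>"
    using assms unfolding test_function_def by blast
  then have "continuous_on UNIV (gradient \<phi>)"
    by (auto simp: gradient_def[abs_def] intro!: continuous_on_vec_lambda)
  then show ?thesis
    by (rule continuous_on_subset) simp
qed

lemma gradient_outside_support:
  fixes f :: "real^'n::finite \<Rightarrow> real"
  assumes "x \<notin> closure {x. f x \<noteq> 0}"
  shows "gradient f x = 0"
proof (rule gradient_eqI)
  have "((\<lambda>_. 0) has_derivative (\<lambda>h. 0 \<bullet> h)) (at x)"
    by simp
  then show "(f has_derivative (\<lambda>h. 0 \<bullet> h)) (at x)"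
    by (rule has_derivative_transform_within_open[of _ _ _ _ "- closure {x. f x \<noteq> 0}"])
      (use assms closure_subset[of "{x. f x \<noteq> 0}"] in auto)
qed

lemma test_functionE:
  assumes "test_function D \<phi>"
  obtains K where "compact K" "K \<subseteq> D" "\<forall>x. x \<notin> K \<longrightarrow> \<phi> x = 0 \<and> gradient \<phi> x = 0"
proof
  show "compact (closure {x. \<phi> x \<noteq> 0})" "closure {x. \<phi> x \<noteq> 0} \<subseteq> D"
    using assms by (auto simp: test_function_def)
  show "\<forall>x. x \<notin> closure {x. \<phi> x \<noteq> 0} \<longrightarrow> \<phi> x = 0 \<and> gradient \<phi> x = 0"
    using closure_subset[of "{x. \<phi> x \<noteq> 0}"] gradient_outside_support by auto
qed

lemma test_function_locally_lipschitz_at: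
  assumes "test_function D \<phi>"
  shows "locally_lipschitz_at \<phi> x"
  using test_function_has_derivative_gradient[OF assms] test_function_continuous_gradient[OF assms]
  by (rule continuous_gradient_imp_locally_lipschitz_at)

lemma lipschitz_mult_test_function:
  fixes u :: "real^'n::finite \<Rightarrow> real"
  assumes lip: "\<And>x. x \<in> D \<Longrightarrow> locally_lipschitz_at u x" and \<phi>: "test_function D \<phi>"
  obtains L where "L-lipschitz_on UNIV (\<lambda>x. u x * \<phi> x)"
proof -
  obtain K where K: "compact K" "K \<subseteq> D" and \<phi>0: "\<forall>x. x \<notin> K \<longrightarrow> \<phi> x = 0 \<and> gradient \<phi> x = 0"
    using test_functionE[OF \<phi>] .
  have "locally_lipschitz_at (\<lambda>x. u x * \<phi> x) x" for x
  proof (cases "x \<in> K")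
    case True
    then show ?thesis
      using K(2)
      by (intro locally_lipschitz_at_mult lip test_function_locally_lipschitz_at[OF \<phi>]) blast
  next
    case False
    show ?thesis
    proof (rule locally_lipschitz_atI)
      show "0-lipschitz_on (- K) (\<lambda>x. u x * \<phi> x)"
        using lipschitz_on_constant by (rule lipschitz_on_transform) (simp add: \<phi>0)
    qed (use False K(1) compact_imp_closed in auto)
  qed
  then show ?thesis
    by (rule locally_lipschitz_bounded_support_imp_lipschitz[OF _ compact_imp_bounded[OF K(1)]])
      (auto simp: \<phi>0 intro: that)
qed

lemma has_derivative_mult_test_function:
  fixes u :: "real^'n::finite \<Rightarrow> real"
  assumes der: "x \<in> D \<Longrightarrow> (u has_derivative (\<lambda>h. g \<bullet> h)) (at x)" and \<phi>: "test_function D \<phi>"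
  shows "((\<lambda>x. u x * \<phi> x) has_derivative (\<lambda>h. (\<phi> x *\<^sub>R g + u x *\<^sub>R gradient \<phi> x) \<bullet> h)) (at x)"
proof -
  obtain K where K: "compact K" "K \<subseteq> D" and \<phi>0: "\<forall>x. x \<notin> K \<longrightarrow> \<phi> x = 0 \<and> gradient \<phi> x = 0"
    using test_functionE[OF \<phi>] .
  show ?thesis
  proof (cases "x \<in> K")
    case True
    then have "x \<in> D"
      using K(2) by blast
    from has_derivative_mult[OF der[OF this] test_function_has_derivative_gradient[OF \<phi>]] show ?thesis
      by (simp add: inner_add_left algebra_simps)
  next
    case False
    have "((\<lambda>_. 0) has_derivative (\<lambda>_. 0)) (at x)"
      by simp
    then have "((\<lambda>x. u x * \<phi> x) has_derivative (\<lambda>_. 0)) (at x)"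
      by (rule has_derivative_transform_within_open[of _ _ _ _ "- K"])
        (use False K(1) compact_imp_closed in \<open>auto simp: \<phi>0\<close>)
    with False show ?thesis
      by (simp add: \<phi>0)
  qed
qed

lemma integrable_mult_partial_deriv_test_function:
  assumes "\<And>x. x \<in> D \<Longrightarrow> isCont u x" and \<phi>: "test_function D \<phi>"
  shows "integrable lebesgue (\<lambda>x. u x * partial_deriv i \<phi> x)"
proof -
  obtain K where K: "compact K" "K \<subseteq> D" and \<phi>0: "\<forall>x. x \<notin> K \<longrightarrow> \<phi> x = 0 \<and> gradient \<phi> x = 0"
    using test_functionE[OF \<phi>] .
  have "continuous_on K u"
    using assms(1) K(2) by (intro continuous_at_imp_continuous_on) blast
  then have "continuous_on K (\<lambda>x. u x * gradient \<phi> x $ i)"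
    by (intro continuous_intros test_function_continuous_gradient[OF \<phi>])
  then have "integrable lebesgue (\<lambda>x. u x * gradient \<phi> x $ i)"
    using K(1) \<phi>0 by (intro integrable_lebesgue_compact_support[of K]) auto
  then show ?thesis
    by (simp add: gradient_def)
qed

lemma integral_lebesgue_on_eq_integral:
  fixes f :: "'a::euclidean_space \<Rightarrow> 'b::{banach, second_countable_topology}"
  assumes "D \<in> sets lebesgue" "\<And>x. x \<notin> D \<Longrightarrow> f x = 0"
  shows "integral\<^sup>L (lebesgue_on D) f = integral\<^sup>L lebesgue f"
proof -
  have "(\<lambda>x. indicator D x *\<^sub>R f x) = f"
    using assms(2) by (auto simp: indicator_def fun_eq_iff)
  then show ?thesis
    using assms(1) by (simp add: integral_restrict_space)
qed

lemma integral_derivative_mult_test_function_eq_0: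
  fixes u :: "real^'n::finite \<Rightarrow> real"
  assumes lip: "\<And>x. x \<in> D \<Longrightarrow> locally_lipschitz_at u x" and N: "negligible N"
    and der: "\<And>x. x \<in> D - N \<Longrightarrow> (u has_derivative (\<lambda>h. g x \<bullet> h)) (at x)"
    and \<phi>: "test_function D \<phi>"
  shows "integrable lebesgue (\<lambda>x. g x $ i * \<phi> x + u x * partial_deriv i \<phi> x)" (is "integrable _ ?F")
    and "integral\<^sup>L lebesgue (\<lambda>x. g x $ i * \<phi> x + u x * partial_deriv i \<phi> x) = 0"
proof -
  let ?v = "\<lambda>x. u x * \<phi> x"
  obtain K where K: "compact K" "K \<subseteq> D" and \<phi>0: "\<forall>x. x \<notin> K \<longrightarrow> \<phi> x = 0 \<and> gradient \<phi> x = 0"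
    using test_functionE[OF \<phi>] .
  obtain L where L: "L-lipschitz_on UNIV ?v"
    using lipschitz_mult_test_function[OF lip \<phi>] .
  have "AE x in lebesgue. x \<notin> N"
    using N AE_not_in negligible_iff_null_sets by blast
  then have deriv: "AE x in lebesgue.
      ((\<lambda>t. ?v (x + t *\<^sub>R axis i 1)) has_real_derivative ?F x) (at 0)"
  proof eventually_elim
    case (elim x)
    then have "(?v has_derivative (\<lambda>h. (\<phi> x *\<^sub>R g x + u x *\<^sub>R gradient \<phi> x) \<bullet> h)) (at x)"
      by (intro has_derivative_mult_test_function[OF _ \<phi>] der) simp
    from has_derivative_along_line[OF this, of "axis i 1"] show ?case
      by (simp add: gradient_def inner_axis mult.commute)
  qed
  have "?v x = 0" if "x \<notin> K" for x
    using that \<phi>0 by simp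
  from integral_directional_derivative_eq_0[OF L compact_imp_bounded[OF K(1)] this deriv]
  show "integrable lebesgue ?F" "integral\<^sup>L lebesgue ?F = 0"
    by simp_all
qed

lemma weak_gradient_locally_lipschitz:
  fixes u :: "real^'n::finite \<Rightarrow> real"
  assumes D: "D \<in> sets lebesgue" and lip: "\<And>x. x \<in> D \<Longrightarrow> locally_lipschitz_at u x"
    and N: "negligible N"
    and der: "\<And>x. x \<in> D - N \<Longrightarrow> (u has_derivative (\<lambda>h. g x \<bullet> h)) (at x)"
  shows "weak_gradient D u g"
  unfolding weak_gradient_def
proof (intro allI impI)
  fix \<phi> i assume \<phi>: "test_function D \<phi>"
  note total = integral_derivative_mult_test_function_eq_0[OF lip N der \<phi>, of i]
  obtain K where K: "compact K" "K \<subseteq> D" and \<phi>0: "\<forall>x. x \<notin> K \<longrightarrow> \<phi> x = 0 \<and> gradient \<phi> x = 0"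
    using test_functionE[OF \<phi>] .
  have u: "integrable lebesgue (\<lambda>x. u x * partial_deriv i \<phi> x)"
    using lip \<phi>
    by (intro integrable_mult_partial_deriv_test_function locally_lipschitz_at_imp_isCont)
  then have g: "integrable lebesgue (\<lambda>x. g x $ i * \<phi> x)"
    using Bochner_Integration.integrable_diff[OF total(1) u] by simp
  have outside: "\<phi> x = 0" "partial_deriv i \<phi> x = 0" if "x \<notin> D" for x
    using \<phi>0 K(2) that by (auto simp: gradient_def vec_eq_iff)
  have "integral\<^sup>L (lebesgue_on D) (\<lambda>x. u x * partial_deriv i \<phi> x) =
      integral\<^sup>L lebesgue (\<lambda>x. u x * partial_deriv i \<phi> x)"
    using D by (rule integral_lebesgue_on_eq_integral) (simp add: outside)
  also have "\<dots> = - integral\<^sup>L lebesgue (\<lambda>x. g x $ i * \<phi> x)"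
    using total(2) Bochner_Integration.integral_add[OF g u] by simp
  also have "\<dots> = - integral\<^sup>L (lebesgue_on D) (\<lambda>x. g x $ i * \<phi> x)"
    using D by (subst integral_lebesgue_on_eq_integral) (simp_all add: outside)
  finally show "integral\<^sup>L (lebesgue_on D) (\<lambda>x. u x * partial_deriv i \<phi> x) =
      - integral\<^sup>L (lebesgue_on D) (\<lambda>x. g x $ i * \<phi> x)" .
qed

section \<open>Bounds for \<open>L\<^sup>p\<close> norms\<close>

lemma in_Lp_bounded:
  fixes f :: "real^'n::finite \<Rightarrow> 'b::euclidean_space"
  assumes D: "D \<in> lmeasurable" and f: "f \<in> borel_measurable (lebesgue_on D)"
    and B: "\<And>x. x \<in> D \<Longrightarrow> norm (f x) \<le> B" and "0 \<le> p"
  shows "in_Lp p D f"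
proof -
  interpret finite_measure "lebesgue_on D"
    using D by (rule finite_measure_lebesgue_on)
  have "norm (f x) powr p \<le> B powr p" if "x \<in> D" for x
    using B[OF that] \<open>0 \<le> p\<close> by (intro powr_mono2) auto
  then have "integrable (lebesgue_on D) (\<lambda>x. norm (f x) powr p)"
    using f by (intro integrable_const_bound[of _ "B powr p"] AE_I2) auto
  with f show ?thesis
    by (simp add: in_Lp_def)
qed

lemma Lp_norm_nonneg: "0 \<le> Lp_norm p D f"
  by (simp add: Lp_norm_def)

lemma integral_lebesgue_on_indicator:
  fixes c :: real
  assumes "D \<in> sets lebesgue" "E \<in> lmeasurable" "E \<subseteq> D"
  shows "integrable (lebesgue_on D) (\<lambda>x. c * indicator E x)"
    and "integral\<^sup>L (lebesgue_on D) (\<lambda>x. c * indicator E x) = c * measure lebesgue E"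
proof -
  have E: "E \<inter> D = E"
    using assms(3) by blast
  have "integrable (lebesgue_on D) (indicator E :: _ \<Rightarrow> real)"
    using assms E
    by (intro integrable_real_indicator)
      (auto simp: sets_restrict_space_iff emeasure_restrict_space fmeasurable_def)
  then show "integrable (lebesgue_on D) (\<lambda>x. c * indicator E x)"
    by simp
  show "integral\<^sup>L (lebesgue_on D) (\<lambda>x. c * indicator E x) = c * measure lebesgue E"
    using assms E by (simp add: measure_restrict_space)
qed

lemma Lp_norm_ge_on_subset:
  assumes "0 < p" "D \<in> sets lebesgue" "E \<in> lmeasurable" "E \<subseteq> D" and f: "in_Lp p D f"
    and "0 \<le> t" and t: "\<And>x. x \<in> E \<Longrightarrow> t \<le> norm (f x)"
  shows "t * measure lebesgue E powr (1 / p) \<le> Lp_norm p D f"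
proof -
  note E = integral_lebesgue_on_indicator[OF assms(2-4), of "t powr p"]
  have "t powr p * measure lebesgue E = integral\<^sup>L (lebesgue_on D) (\<lambda>x. t powr p * indicator E x)"
    by (simp only: E(2))
  also have "\<dots> \<le> integral\<^sup>L (lebesgue_on D) (\<lambda>x. norm (f x) powr p)"
  proof (rule integral_mono[OF E(1)])
    show "integrable (lebesgue_on D) (\<lambda>x. norm (f x) powr p)"
      using f by (simp add: in_Lp_def)
    show "t powr p * indicator E x \<le> norm (f x) powr p" for x
      using t[of x] \<open>0 < p\<close> \<open>0 \<le> t\<close> by (auto simp: indicator_def intro!: powr_mono2)
  qed
  finally have "(t powr p * measure lebesgue E) powr (1 / p) \<le> Lp_norm p D f"
    unfolding Lp_norm_def using \<open>0 < p\<close> by (intro powr_mono2) auto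
  then show ?thesis
    using \<open>0 < p\<close> \<open>0 \<le> t\<close> by (simp add: powr_mult powr_powr)
qed

lemma Lp_norm_le_on_subset:
  assumes "0 < p" "D \<in> sets lebesgue" "E \<in> lmeasurable" "E \<subseteq> D"
    and "0 \<le> t" and t: "\<And>x. norm (f x) \<le> t * indicator E x"
  shows "Lp_norm p D f \<le> t * measure lebesgue E powr (1 / p)"
proof -
  note E = integral_lebesgue_on_indicator[OF assms(2-4), of "t powr p"]
  have "integral\<^sup>L (lebesgue_on D) (\<lambda>x. norm (f x) powr p) \<le>
      integral\<^sup>L (lebesgue_on D) (\<lambda>x. t powr p * indicator E x)"
  proof (rule integral_mono'[OF E(1)])
    show "norm (f x) powr p \<le> t powr p * indicator E x" for x
      using t[of x] \<open>0 < p\<close> by (auto simp: indicator_def intro!: powr_mono2 split: if_splits)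
  qed simp
  also have "\<dots> = t powr p * measure lebesgue E"
    by (simp only: E(2))
  finally have "Lp_norm p D f \<le> (t powr p * measure lebesgue E) powr (1 / p)"
    unfolding Lp_norm_def using \<open>0 < p\<close> by (intro powr_mono2) auto
  then show ?thesis
    using \<open>0 < p\<close> \<open>0 \<le> t\<close> by (simp add: powr_mult powr_powr)
qed

text \<open>No estimate of the average is needed in the Poincare inequality: any constant is at distance
  at least \<open>\<bar>s - t\<bar> / 2\<close> from one of the two values.\<close>

lemma Lp_norm_diff_const_ge_two_values:
  fixes u :: "real^'n::finite \<Rightarrow> real"
  assumes "0 < p" "D \<in> sets lebesgue" and u: "in_Lp p D (\<lambda>x. u x - c)"
    and A: "A \<in> lmeasurable" "A \<subseteq> D" "\<And>x. x \<in> A \<Longrightarrow> u x = s"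
    and B: "B \<in> lmeasurable" "B \<subseteq> D" "\<And>x. x \<in> B \<Longrightarrow> u x = t"
    and v: "0 \<le> v" "v \<le> measure lebesgue A" "v \<le> measure lebesgue B"
  shows "\<bar>s - t\<bar> / 2 * v powr (1 / p) \<le> Lp_norm p D (\<lambda>x. u x - c)"
proof -
  have bound: "\<bar>s - t\<bar> / 2 * v powr (1 / p) \<le> Lp_norm p D (\<lambda>x. u x - c)"
    if E: "E \<in> lmeasurable" "E \<subseteq> D" "\<And>x. x \<in> E \<Longrightarrow> \<bar>s - t\<bar> / 2 \<le> \<bar>u x - c\<bar>"
      and v_le: "v \<le> measure lebesgue E" for E
  proof -
    have "\<bar>s - t\<bar> / 2 * v powr (1 / p) \<le> \<bar>s - t\<bar> / 2 * measure lebesgue E powr (1 / p)"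
      using v(1) v_le \<open>0 < p\<close> by (intro mult_left_mono powr_mono2) auto
    also have "\<dots> \<le> Lp_norm p D (\<lambda>x. u x - c)"
      using assms(1,2) E u by (intro Lp_norm_ge_on_subset) auto
    finally show ?thesis .
  qed
  consider (far_from_s) "\<bar>s - t\<bar> / 2 \<le> \<bar>s - c\<bar>" | (far_from_t) "\<bar>s - t\<bar> / 2 \<le> \<bar>t - c\<bar>"
    using abs_triangle_ineq4[of "s - c" "t - c"] by fastforce
  then show ?thesis
  proof cases
    case far_from_s
    with A v show ?thesis
      by (intro bound[of A]) auto
  next
    case far_from_t
    with B v show ?thesis
      by (intro bound[of B]) auto
  qed
qed

lemma poincare_imp_Lp_norm_diff_const_le:
  fixes D :: "(real^'n::finite) set"
  assumes "poincare q p D"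
  obtains c where "0 \<le> c" "\<forall>u g. sobolev_W1p p D u g \<longrightarrow>
    (\<exists>a. in_Lp q D (\<lambda>x. u x - a) \<and> Lp_norm q D (\<lambda>x. u x - a) \<le> c * Lp_norm p D g)"
proof -
  obtain c where c: "sobolev_W1p p D u g \<Longrightarrow> in_Lp q D (\<lambda>x. u x - average D u) \<and>
      Lp_norm q D (\<lambda>x. u x - average D u) \<le> c * Lp_norm p D g" for u g
    using assms unfolding poincare_def by blast
  show ?thesis
  proof (rule that[of "\<bar>c\<bar>"], simp, intro allI impI)
    fix u g assume "sobolev_W1p p D u g"
    note c[OF this]
    moreover have "c * Lp_norm p D g \<le> \<bar>c\<bar> * Lp_norm p D g"
      by (intro mult_right_mono Lp_norm_nonneg) simp
    ultimately show "\<exists>a. in_Lp q D (\<lambda>x. u x - a) \<and>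
        Lp_norm q D (\<lambda>x. u x - a) \<le> \<bar>c\<bar> * Lp_norm p D g"
      by (intro exI[of _ "average D u"]) simp
  qed
qed

section \<open>The test function of an apartment\<close>

definition ramp :: "real \<Rightarrow> real \<Rightarrow> real \<Rightarrow> real"
  where "ramp a h t = max 0 (min 1 ((a + h - t) / h))"

lemma ramp_bounds: "0 \<le> ramp a h t" "ramp a h t \<le> 1"
  by (auto simp: ramp_def)

lemma ramp_eq_1: "0 < h \<Longrightarrow> t \<le> a \<Longrightarrow> ramp a h t = 1"
  by (simp add: ramp_def)

lemma ramp_eq_0: "0 < h \<Longrightarrow> a + h \<le> t \<Longrightarrow> ramp a h t = 0"
  by (simp add: ramp_def divide_nonpos_pos)

lemma lipschitz_on_ramp:
  assumes "0 < h"
  shows "(1 / h)-lipschitz_on X (ramp a h)"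
proof (rule lipschitz_onI)
  fix s t
  have "dist (ramp a h s) (ramp a h t) \<le> \<bar>(a + h - s) / h - (a + h - t) / h\<bar>"
    unfolding ramp_def dist_real_def by linarith
  also have "\<dots> = 1 / h * dist s t"
    using assms
    by (simp add: diff_divide_distrib[symmetric] abs_divide dist_real_def abs_minus_commute)
  finally show "dist (ramp a h s) (ramp a h t) \<le> 1 / h * dist s t" .
qed (use assms in simp)

lemma lipschitz_on_ramp_component:
  assumes "0 < h"
  shows "(1 / h)-lipschitz_on X (\<lambda>y. ramp a h (y $ m))"
proof (rule lipschitz_onI)
  fix y z
  have "dist (ramp a h (y $ m)) (ramp a h (z $ m)) \<le> 1 / h * dist (y $ m) (z $ m)"
    using lipschitz_onD[OF lipschitz_on_ramp[OF assms, of UNIV a]] by blast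
  also have "\<dots> \<le> 1 / h * dist y z"
    using assms by (intro mult_left_mono dist_vec_nth_le) simp
  finally show "dist (ramp a h (y $ m)) (ramp a h (z $ m)) \<le> 1 / h * dist y z" .
qed (use assms in simp)

lemma ramp_has_real_derivative:
  assumes "0 < h" "t \<noteq> a" "t \<noteq> a + h"
  shows "(ramp a h has_real_derivative - indicator {a<..<a + h} t / h) (at t)"
proof -
  consider (below) "t < a" | (inside) "a < t" "t < a + h" | (above) "a + h < t"
    using assms by linarith
  then show ?thesis
  proof cases
    case below
    have "((\<lambda>_. 1) has_real_derivative 0) (at t)"
      by simp
    then have "(ramp a h has_real_derivative 0) (at t)"
      by (rule has_field_derivative_transform_within_open[of _ _ _ "{..<a}"])
        (use below assms(1) in \<open>auto simp: ramp_eq_1\<close>)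
    with below show ?thesis
      by simp
  next
    case inside
    have "((\<lambda>t. (a + h - t) / h) has_real_derivative - 1 / h) (at t)"
      using assms(1) by (auto intro!: derivative_eq_intros)
    then have "(ramp a h has_real_derivative - 1 / h) (at t)"
      by (rule has_field_derivative_transform_within_open[of _ _ _ "{a<..<a + h}"])
        (use inside assms(1) in \<open>auto simp: ramp_def\<close>)
    with inside show ?thesis
      by simp
  next
    case above
    have "((\<lambda>_. 0) has_real_derivative 0) (at t)"
      by simp
    then have "(ramp a h has_real_derivative 0) (at t)"
      by (rule has_field_derivative_transform_within_open[of _ _ _ "{a + h<..}"])
        (use above assms(1) in \<open>auto simp: ramp_eq_0\<close>)
    with above show ?thesis
      by simp
  qed
qed

lemma ramp_component_has_derivative:
  fixes y :: "real^'n::finite"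
  assumes "0 < h" "y $ m \<noteq> a" "y $ m \<noteq> a + h"
  shows "((\<lambda>y. ramp a h (y $ m)) has_derivative
    (\<lambda>d. ((- indicator {a<..<a + h} (y $ m) / h) *\<^sub>R axis m 1) \<bullet> d)) (at y)"
proof -
  have "((\<lambda>y. y $ m) has_derivative (\<lambda>d. d $ m)) (at y)"
    by (intro bounded_linear_imp_has_derivative bounded_linear_vec_nth)
  from has_derivative_compose[OF this
      ramp_has_real_derivative[OF assms, THEN has_field_derivative_imp_has_derivative]]
  show ?thesis
    by (simp add: inner_commute[of "axis m 1"] inner_axis)
qed

definition passage_width :: "real \<Rightarrow> real \<Rightarrow> real"
  where "passage_width \<beta> l = (l / 8) powr (1 / \<beta>)"

lemma passage_width_pos: "0 < l \<Longrightarrow> 0 < passage_width \<beta> l"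
  by (simp add: passage_width_def)

lemma passage_width_powr:
  assumes "0 < l"
  shows "passage_width \<beta> l powr t = l powr (t / \<beta>) * 8 powr (- (t / \<beta>))"
  using assms by (simp add: passage_width_def powr_powr powr_divide powr_minus_divide)

lemma passage_width_le:
  assumes "0 < l" "l \<le> 8" "0 < \<beta>" "\<beta> \<le> 1"
  shows "passage_width \<beta> l \<le> l / 8"
proof -
  have "(l / 8) powr (1 / \<beta>) \<le> (l / 8) powr 1"
    using assms by (intro powr_mono') auto
  then show ?thesis
    using assms by (simp add: passage_width_def)
qed

lemma mem_passage_iff:
  "y \<in> passage m \<beta> x l \<longleftrightarrow>
    (\<forall>i. i \<noteq> m \<longrightarrow> x $ i - passage_width \<beta> l < y $ i \<and> y $ i < x $ i + passage_width \<beta> l) \<and>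
    x $ m + l / 8 < y $ m \<and> y $ m < x $ m + l / 8 + passage_width \<beta> l"
  by (simp add: passage_def passage_width_def)

lemma mem_long_passage_iff:
  "y \<in> long_passage m \<beta> x l \<longleftrightarrow>
    (\<forall>i. i \<noteq> m \<longrightarrow> x $ i - passage_width \<beta> l < y $ i \<and> y $ i < x $ i + passage_width \<beta> l) \<and>
    x $ m < y $ m \<and> y $ m < x $ m + l / 2"
  by (simp add: long_passage_def passage_width_def)

lemma cube_eq_cbox: "cube x l = cbox (\<chi> i. x $ i - l / 2) (\<chi> i. x $ i + l / 2)"
  by (auto simp: cube_def mem_box_cart)

lemma mem_interior_cube_iff:
  "y \<in> interior (cube x l) \<longleftrightarrow> (\<forall>i. x $ i - l / 2 < y $ i \<and> y $ i < x $ i + l / 2)"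
  by (simp add: cube_eq_cbox mem_box_cart)

lemma room_eq_box: "room x l = box (\<chi> i. x $ i - l / 8) (\<chi> i. x $ i + l / 8)"
  by (auto simp: room_def mem_box_cart)

lemma passage_eq_box:
  "passage m \<beta> x l =
    box (\<chi> i. if i = m then x $ m + l / 8 else x $ i - passage_width \<beta> l)
        (\<chi> i. if i = m then x $ m + l / 8 + passage_width \<beta> l else x $ i + passage_width \<beta> l)"
  by (auto simp: mem_passage_iff mem_box_cart split: if_splits)

lemma long_passage_eq_box:
  "long_passage m \<beta> x l =
    box (\<chi> i. if i = m then x $ m else x $ i - passage_width \<beta> l)
        (\<chi> i. if i = m then x $ m + l / 2 else x $ i + passage_width \<beta> l)"
  by (auto simp: mem_long_passage_iff mem_box_cart split: if_splits)

lemma mem_closure_room_iff: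
  assumes "0 < l"
  shows "y \<in> closure (room x l) \<longleftrightarrow> (\<forall>i. x $ i - l / 8 \<le> y $ i \<and> y $ i \<le> x $ i + l / 8)"
proof -
  have "room x l \<noteq> {}"
    using assms by (auto simp: room_eq_box interval_eq_empty_cart)
  then show ?thesis
    by (simp add: room_eq_box closure_box mem_box_cart)
qed

lemma mem_closure_passage_iff:
  assumes "0 < l"
  shows "y \<in> closure (passage m \<beta> x l) \<longleftrightarrow>
    (\<forall>i. i \<noteq> m \<longrightarrow> x $ i - passage_width \<beta> l \<le> y $ i \<and> y $ i \<le> x $ i + passage_width \<beta> l) \<and>
    x $ m + l / 8 \<le> y $ m \<and> y $ m \<le> x $ m + l / 8 + passage_width \<beta> l"
proof -
  have "passage m \<beta> x l \<noteq> {}"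
    using passage_width_pos[OF assms, of \<beta>] by (auto simp: passage_eq_box interval_eq_empty_cart)
  then show ?thesis
    by (auto simp: passage_eq_box closure_box mem_box_cart split: if_splits)
qed

definition chamber :: "'n \<Rightarrow> real \<Rightarrow> real^'n::finite \<Rightarrow> real \<Rightarrow> (real^'n) set"
  where "chamber m \<beta> x l = room x l \<union> long_passage m \<beta> x l"

definition exterior :: "'n \<Rightarrow> real \<Rightarrow> real^'n::finite \<Rightarrow> real \<Rightarrow> (real^'n) set"
  where "exterior m \<beta> x l = - (closure (room x l) \<union> closure (passage m \<beta> x l))"

text \<open>The chamber and the exterior are open and cover the \<open>\<beta>\<close>-version, and the function below is
  Lipschitz on each of them; the walls where it jumps belong to neither.\<close>

definition chamber_fun :: "'n \<Rightarrow> real \<Rightarrow> real^'n::finite \<Rightarrow> real \<Rightarrow> real^'n \<Rightarrow> real"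
  where "chamber_fun m \<beta> x l y =
    (if y \<in> chamber m \<beta> x l then ramp (x $ m + l / 8) (passage_width \<beta> l) (y $ m) else 0)"

definition chamber_grad :: "'n \<Rightarrow> real \<Rightarrow> real^'n::finite \<Rightarrow> real \<Rightarrow> real^'n \<Rightarrow> real^'n"
  where "chamber_grad m \<beta> x l y =
    (- indicator (passage m \<beta> x l) y / passage_width \<beta> l) *\<^sub>R axis m 1"

lemma open_chamber: "open (chamber m \<beta> x l)"
  by (auto simp: chamber_def room_eq_box long_passage_eq_box)

lemma open_exterior: "open (exterior m \<beta> x l)"
  by (auto simp: exterior_def)

lemma chamber_fun_bounds: "0 \<le> chamber_fun m \<beta> x l y" "chamber_fun m \<beta> x l y \<le> 1"
  by (auto simp: chamber_fun_def ramp_bounds)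

lemma room_Int_exterior: "room x l \<inter> exterior m \<beta> x l = {}"
  using closure_subset[of "room x l"] by (auto simp: exterior_def)

lemma passage_Int_exterior: "passage m \<beta> x l \<inter> exterior m \<beta> x l = {}"
  using closure_subset[of "passage m \<beta> x l"] by (auto simp: exterior_def)

lemma cube_Int_exterior_subset_apartment: "cube x l \<inter> exterior m \<beta> x l \<subseteq> apartment m \<beta> x l"
  by (auto simp: apartment_def exterior_def closure_Un_frontier)

lemma room_subset_interior_cube:
  assumes "0 < l"
  shows "room x l \<subseteq> interior (cube x l)"
proof
  fix y assume "y \<in> room x l"
  then have near: "x $ i - l / 8 < y $ i \<and> y $ i < x $ i + l / 8" for i
    by (simp add: room_def)
  have "x $ i - l / 2 < y $ i \<and> y $ i < x $ i + l / 2" for i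
    using near[of i] assms by linarith
  then show "y \<in> interior (cube x l)"
    by (simp add: mem_interior_cube_iff)
qed

lemma room_subset_apartment:
  assumes "0 < l"
  shows "room x l \<subseteq> apartment m \<beta> x l"
proof -
  have "room x l \<inter> frontier (room x l) = {}"
    unfolding room_eq_box by (subst Int_commute, subst frontier_disjoint_eq) (rule open_box)
  moreover have "y \<notin> frontier (passage m \<beta> x l)" if "y \<in> room x l" for y
  proof -
    have "y $ m < x $ m + l / 8"
      using that by (simp add: room_def)
    then show ?thesis
      by (simp add: frontier_def mem_closure_passage_iff[OF assms])
  qed
  ultimately show ?thesis
    using room_subset_interior_cube[OF assms, of x] interior_subset[of "cube x l"]
    by (auto simp: apartment_def)
qed

context
  fixes m :: "'n::finite" and \<beta> l :: real and x :: "real^'n"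
  assumes l: "0 < l" and width: "passage_width \<beta> l \<le> l / 8"
begin

lemma chamber_subset_interior_cube: "chamber m \<beta> x l \<subseteq> interior (cube x l)"
proof -
  have "y \<in> interior (cube x l)" if y: "y \<in> long_passage m \<beta> x l" for y
  proof -
    have "x $ i - l / 2 < y $ i \<and> y $ i < x $ i + l / 2" for i
      using y[unfolded mem_long_passage_iff] l width by (cases "i = m") (auto dest!: spec[of _ i])
    then show ?thesis
      by (simp add: mem_interior_cube_iff)
  qed
  then show ?thesis
    using room_subset_interior_cube[OF l] by (auto simp: chamber_def)
qed

lemma exterior_Un_interior_cube: "exterior m \<beta> x l \<union> interior (cube x l) = UNIV"
proof -
  have "closure (room x l) \<subseteq> interior (cube x l)"
  proof
    fix y assume y: "y \<in> closure (room x l)"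
    have "x $ i - l / 2 < y $ i \<and> y $ i < x $ i + l / 2" for i
      using y[unfolded mem_closure_room_iff[OF l], rule_format, of i] l by linarith
    then show "y \<in> interior (cube x l)"
      by (simp add: mem_interior_cube_iff)
  qed
  moreover have "closure (passage m \<beta> x l) \<subseteq> interior (cube x l)"
  proof
    fix y assume y: "y \<in> closure (passage m \<beta> x l)"
    have "x $ i - l / 2 < y $ i \<and> y $ i < x $ i + l / 2" for i
      using y[unfolded mem_closure_passage_iff[OF l]] l width
      by (cases "i = m") (auto dest!: spec[of _ i])
    then show "y \<in> interior (cube x l)"
      by (simp add: mem_interior_cube_iff)
  qed
  ultimately show ?thesis
    by (auto simp: exterior_def)
qed

lemma passage_eq_chamber_Int_slab:
  "passage m \<beta> x l =
    chamber m \<beta> x l \<inter> {y. y $ m \<in> {x $ m + l / 8<..<x $ m + l / 8 + passage_width \<beta> l}}"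
proof -
  have "y \<notin> room x l" if "x $ m + l / 8 < y $ m" for y
    using that by (auto simp: room_def intro!: exI[of _ m])
  then show ?thesis
    using l width by (auto simp: chamber_def mem_passage_iff mem_long_passage_iff)
qed

lemma apartment_subset_cube: "apartment m \<beta> x l \<subseteq> cube x l"
  using chamber_subset_interior_cube interior_subset[of "cube x l"]
  by (auto simp: apartment_def chamber_def)

lemma apartment_subset_chamber_Un_exterior:
  "apartment m \<beta> x l \<subseteq> chamber m \<beta> x l \<union> exterior m \<beta> x l"
  using passage_eq_chamber_Int_slab
  by (auto simp: apartment_def chamber_def exterior_def closure_Un_frontier)

lemma chamber_Int_exterior:
  assumes y: "y \<in> chamber m \<beta> x l" "y \<in> exterior m \<beta> x l"
  shows "x $ m + l / 8 + passage_width \<beta> l < y $ m"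
proof (rule ccontr)
  assume "\<not> ?thesis"
  then have below: "y $ m \<le> x $ m + l / 8 + passage_width \<beta> l"
    by simp
  have "y \<in> long_passage m \<beta> x l"
    using y room_Int_exterior[of x l m \<beta>] by (auto simp: chamber_def)
  then have above: "x $ m < y $ m"
    and across: "\<And>i. i \<noteq> m \<Longrightarrow> x $ i - passage_width \<beta> l < y $ i \<and> y $ i < x $ i + passage_width \<beta> l"
    by (auto simp: mem_long_passage_iff)
  show False
  proof (cases "y $ m \<le> x $ m + l / 8")
    case True
    have "x $ i - l / 8 \<le> y $ i \<and> y $ i \<le> x $ i + l / 8" for i
      using True across[of i] above width l by (cases "i = m") auto
    then have "y \<in> closure (room x l)"
      by (simp add: mem_closure_room_iff[OF l])
    then show False
      using y(2) by (simp add: exterior_def)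
  next
    case False
    then have "y \<in> closure (passage m \<beta> x l)"
      using below across by (auto simp: mem_closure_passage_iff[OF l] less_imp_le)
    then show False
      using y(2) by (simp add: exterior_def)
  qed
qed

lemma chamber_fun_exterior: "y \<in> exterior m \<beta> x l \<Longrightarrow> chamber_fun m \<beta> x l y = 0"
  using chamber_Int_exterior[of y] passage_width_pos[OF l, of \<beta>]
  by (auto simp: chamber_fun_def ramp_eq_0)

lemma chamber_fun_locally_lipschitz_at:
  assumes "y \<in> chamber m \<beta> x l \<union> exterior m \<beta> x l"
  shows "locally_lipschitz_at (chamber_fun m \<beta> x l) y"
  using assms
proof
  assume y: "y \<in> chamber m \<beta> x l"
  have "(1 / passage_width \<beta> l)-lipschitz_on (chamber m \<beta> x l) (chamber_fun m \<beta> x l)"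
    using lipschitz_on_ramp_component[OF passage_width_pos[OF l]]
    by (rule lipschitz_on_transform) (simp add: chamber_fun_def)
  then show ?thesis
    using open_chamber y by (rule locally_lipschitz_atI)
next
  assume y: "y \<in> exterior m \<beta> x l"
  have "0-lipschitz_on (exterior m \<beta> x l) (chamber_fun m \<beta> x l)"
    using lipschitz_on_constant by (rule lipschitz_on_transform) (simp add: chamber_fun_exterior)
  then show ?thesis
    using open_exterior y by (rule locally_lipschitz_atI)
qed

lemma chamber_fun_has_derivative:
  assumes y: "y \<in> chamber m \<beta> x l \<union> exterior m \<beta> x l"
    and kinks: "y $ m \<noteq> x $ m + l / 8" "y $ m \<noteq> x $ m + l / 8 + passage_width \<beta> l"
  shows "(chamber_fun m \<beta> x l has_derivative (\<lambda>d. chamber_grad m \<beta> x l y \<bullet> d)) (at y)"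
  using y
proof
  assume y: "y \<in> chamber m \<beta> x l"
  then have "chamber_grad m \<beta> x l y =
      (- indicator {x $ m + l / 8<..<x $ m + l / 8 + passage_width \<beta> l} (y $ m) / passage_width \<beta> l)
        *\<^sub>R axis m 1"
    unfolding chamber_grad_def passage_eq_chamber_Int_slab by (simp add: indicator_def)
  with ramp_component_has_derivative[OF passage_width_pos[OF l] kinks]
  have "((\<lambda>y. ramp (x $ m + l / 8) (passage_width \<beta> l) (y $ m)) has_derivative
      (\<lambda>d. chamber_grad m \<beta> x l y \<bullet> d)) (at y)"
    by (simp only:)
  then show ?thesis
    by (rule has_derivative_transform_within_open[OF _ open_chamber y]) (simp add: chamber_fun_def)
next
  assume y: "y \<in> exterior m \<beta> x l"
  then have "chamber_grad m \<beta> x l y = 0"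
    using passage_Int_exterior[of m \<beta> x l] by (auto simp: chamber_grad_def indicator_def)
  moreover have "((\<lambda>_. 0) has_derivative (\<lambda>d. 0 \<bullet> d)) (at y)"
    by simp
  ultimately have "((\<lambda>_. 0) has_derivative (\<lambda>d. chamber_grad m \<beta> x l y \<bullet> d)) (at y)"
    by simp
  then show ?thesis
    by (rule has_derivative_transform_within_open[OF _ open_exterior y])
      (simp add: chamber_fun_exterior)
qed

end

lemma chamber_fun_room:
  assumes "0 < l" "y \<in> room x l"
  shows "chamber_fun m \<beta> x l y = 1"
proof -
  have "y $ m < x $ m + l / 8"
    using assms(2) by (simp add: room_def)
  then show ?thesis
    using assms passage_width_pos[OF assms(1), of \<beta>]
    by (simp add: chamber_fun_def ramp_eq_1 chamber_def)
qed

lemma chamber_fun_borel_measurable: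
  assumes "0 < l"
  shows "chamber_fun m \<beta> x l \<in> borel_measurable borel"
proof -
  have "(\<lambda>y. ramp (x $ m + l / 8) (passage_width \<beta> l) (y $ m)) \<in> borel_measurable borel"
    using lipschitz_on_continuous_on[OF lipschitz_on_ramp_component[OF passage_width_pos[OF assms]]]
    by (rule borel_measurable_continuous_onI)
  moreover have "chamber m \<beta> x l \<in> sets borel"
    by (simp add: borel_open open_chamber)
  ultimately show ?thesis
    unfolding chamber_fun_def[abs_def] by (intro measurable_If_set) auto
qed

lemma chamber_grad_borel_measurable: "chamber_grad m \<beta> x l \<in> borel_measurable borel"
proof -
  have "passage m \<beta> x l \<in> sets borel"
    by (simp add: passage_eq_box)
  then show ?thesis
    unfolding chamber_grad_def[abs_def] by measurable
qed

section \<open>Packings of cubes\<close>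

lemma cube_inject:
  fixes x x' :: "real^'n::finite"
  assumes "0 < l" "cube x l = cube x' l'"
  shows "x = x' \<and> l = l'"
proof -
  have "cube x l \<noteq> {}"
    using assms(1) by (auto simp: cube_eq_cbox interval_eq_empty_cart)
  then have "(\<chi> i. x $ i - l / 2) = (\<chi> i. x' $ i - l' / 2)"
    "(\<chi> i. x $ i + l / 2) = (\<chi> i. x' $ i + l' / 2)"
    using assms(2) unfolding cube_eq_cbox eq_cbox by auto
  then have ends: "x $ i - l / 2 = x' $ i - l' / 2 \<and> x $ i + l / 2 = x' $ i + l' / 2" for i
    by (simp add: vec_eq_iff)
  then have "l = l'"
    using ends[of undefined] by linarith
  with ends show ?thesis
    by (simp add: vec_eq_iff)
qed

lemma cube_side_le_diameter:
  fixes x :: "real^'n::finite"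
  assumes "0 \<le> l" "cube x l \<subseteq> S" "bounded S"
  shows "l \<le> diameter S"
proof -
  define e :: "real^'n" where "e = axis undefined 1"
  have "x + (l / 2) *\<^sub>R e \<in> cube x l" "x - (l / 2) *\<^sub>R e \<in> cube x l"
    using assms(1) by (auto simp: cube_def e_def axis_def)
  then have "dist (x + (l / 2) *\<^sub>R e) (x - (l / 2) *\<^sub>R e) \<le> diameter S"
    using assms(2,3) by (intro diameter_bounded_bound) auto
  moreover have "x + (l / 2) *\<^sub>R e - (x - (l / 2) *\<^sub>R e) = l *\<^sub>R e"
    by (simp add: scaleR_left_distrib[symmetric])
  ultimately have "norm (l *\<^sub>R e) \<le> diameter S"
    by (simp only: dist_norm)
  then show ?thesis
    using assms(1) by (simp add: e_def norm_axis_1)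
qed

lemma measure_box_equal_sides:
  fixes a b :: "real^'n::finite"
  assumes "0 \<le> c" "\<And>i. b $ i = a $ i + c"
  shows "measure lebesgue (box a b) = c ^ CARD('n)"
proof -
  have "(b - a) \<bullet> d = c" "a \<bullet> d \<le> b \<bullet> d" if "d \<in> Basis" for d
    using that assms by (auto simp: Basis_vec_def inner_axis)
  then show ?thesis
    by (simp add: measure_completion)
qed

lemma measure_interior_cube:
  fixes x :: "real^'n::finite"
  assumes "0 < l"
  shows "measure lebesgue (interior (cube x l)) = l ^ CARD('n)"
  unfolding cube_eq_cbox interior_cbox using assms by (intro measure_box_equal_sides) auto

lemma measure_room:
  fixes x :: "real^'n::finite"
  assumes "0 < l"
  shows "measure lebesgue (room x l) = (l / 4) ^ CARD('n)"
  unfolding room_eq_box using assms by (intro measure_box_equal_sides) auto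

lemma measure_passage_le:
  fixes x :: "real^'n::finite"
  assumes "0 < l"
  shows "measure lebesgue (passage m \<beta> x l) \<le> (2 * passage_width \<beta> l) ^ CARD('n)"
proof -
  note h = passage_width_pos[OF assms, of \<beta>]
  define a where "a = (\<chi> i. if i = m then x $ m + l / 8 else x $ i - passage_width \<beta> l)"
  have "passage m \<beta> x l \<subseteq> box a (\<chi> i. a $ i + 2 * passage_width \<beta> l)"
    using h by (auto simp: mem_passage_iff a_def mem_box_cart add.commute)
  then have "measure lebesgue (passage m \<beta> x l) \<le>
      measure lebesgue (box a (\<chi> i. a $ i + 2 * passage_width \<beta> l))"
    by (intro measure_mono_fmeasurable) (auto simp: passage_eq_box)
  also have "\<dots> = (2 * passage_width \<beta> l) ^ CARD('n)"
    using h by (intro measure_box_equal_sides) auto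
  finally show ?thesis .
qed

definition corner :: "real^'n::finite \<Rightarrow> real \<Rightarrow> (real^'n) set"
  where "corner x l = room (\<chi> i. x $ i - 3 / 8 * l) l"

lemma corner_subset_exterior:
  assumes "0 < l"
  shows "corner x l \<subseteq> exterior m \<beta> x l"
proof
  fix y assume "y \<in> corner x l"
  then have "y $ m < x $ m - l / 8"
    using assms by (auto simp: corner_def room_def dest!: spec[of _ m])
  then show "y \<in> exterior m \<beta> x l"
    using assms
    by (auto simp: exterior_def mem_closure_room_iff mem_closure_passage_iff not_le intro!: exI[of _ m])
qed

lemma corner_subset_interior_cube:
  assumes "0 < l"
  shows "corner x l \<subseteq> interior (cube x l)"
proof
  fix y assume "y \<in> corner x l"
  then have near: "x $ i - l / 2 < y $ i \<and> y $ i < x $ i - l / 4" for i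
    by (simp add: corner_def room_def)
  have "x $ i - l / 2 < y $ i \<and> y $ i < x $ i + l / 2" for i
    using near[of i] assms by linarith
  then show "y \<in> interior (cube x l)"
    by (simp add: mem_interior_cube_iff)
qed

definition centers :: "(real^'n::finite) set set \<Rightarrow> real \<Rightarrow> (real^'n) set"
  where "centers W l = {x. cube x l \<in> W}"

lemma card_whitney_layer: "card (whitney_layer W k) = card (centers W (1 / 2 ^ k))"
proof -
  have "whitney_layer W k = (\<lambda>x. cube x (1 / 2 ^ k)) ` centers W (1 / 2 ^ k)"
    by (auto simp: whitney_layer_def centers_def)
  moreover have "inj_on (\<lambda>x. cube x (1 / 2 ^ k)) (centers W (1 / 2 ^ k))"
    using cube_inject[of "1 / 2 ^ k"] by (auto simp: inj_on_def)
  ultimately show ?thesis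
    by (simp add: card_image)
qed

locale cube_packing =
  fixes W :: "(real^'n::finite) set set"
  assumes interiors_disjoint: "pairwise (\<lambda>Q Q'. interior Q \<inter> interior Q' = {}) W"
    and bounded_Union: "bounded (\<Union>W)"
begin

lemma interior_cube_Int_cube:
  assumes "cube x l \<in> W" "cube x' l' \<in> W" "cube x l \<noteq> cube x' l'" "0 < l'"
  shows "interior (cube x l) \<inter> cube x' l' = {}"
proof -
  have "interior (cube x l) \<inter> interior (cube x' l') = {}"
    using interiors_disjoint assms(1-3) unfolding pairwise_def by blast
  moreover have "closure (interior (cube x' l')) = cube x' l'"
    using assms(4) by (simp add: cube_eq_cbox closure_box interval_eq_empty_cart)
  ultimately show ?thesis
    using open_Int_closure_eq_empty[OF open_interior] by metis
qed

lemma disjoint_family_on_interiors: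
  assumes "0 < l"
  shows "disjoint_family_on (\<lambda>x. interior (cube x l)) (centers W l)"
  unfolding disjoint_family_on_def centers_def
proof (intro ballI impI)
  fix x x' assume "x \<in> {x. cube x l \<in> W}" "x' \<in> {x. cube x l \<in> W}" "x \<noteq> x'"
  then have "interior (cube x l) \<inter> cube x' l = {}"
    using cube_inject[OF assms] assms by (intro interior_cube_Int_cube) auto
  then show "interior (cube x l) \<inter> interior (cube x' l) = {}"
    using interior_subset by blast
qed

lemma measure_UN_centers:
  assumes "0 < l" "finite F" "F \<subseteq> centers W l"
    and "\<And>x. E x \<subseteq> interior (cube x l)" "\<And>x. E x \<in> lmeasurable" "\<And>x. measure lebesgue (E x) = a"
  shows "measure lebesgue (\<Union>x\<in>F. E x) = real (card F) * a"
proof -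
  have "pairwise (\<lambda>x x'. disjnt (E x) (E x')) F"
    using disjoint_family_on_interiors[OF assms(1)] assms(3,4)
    unfolding pairwise_def disjnt_def disjoint_family_on_def by blast
  then show ?thesis
    using measure_UNION'[OF assms(2), of E lebesgue] assms(5,6) by simp
qed

lemma card_centers_le:
  assumes "0 < l" and S: "S \<in> lmeasurable" "\<Union>W \<subseteq> S"
  shows "finite (centers W l)" and "real (card (centers W l)) * l ^ CARD('n) \<le> measure lebesgue S"
proof -
  have volume: "real (card F) * l ^ CARD('n) \<le> measure lebesgue S"
    if "finite F" "F \<subseteq> centers W l" for F
  proof -
    have "real (card F) * l ^ CARD('n) = measure lebesgue (\<Union>x\<in>F. interior (cube x l))"
      using assms(1) that
      by (intro measure_UN_centers[symmetric] measure_interior_cube) (auto simp: cube_eq_cbox)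
    also have "\<dots> \<le> measure lebesgue S"
    proof (intro measure_mono_fmeasurable UN_least S(1))
      show "interior (cube x l) \<subseteq> S" if "x \<in> F" for x
        using that \<open>F \<subseteq> centers W l\<close> S(2) interior_subset[of "cube x l"] by (auto simp: centers_def)
    qed (auto intro!: sets_completionI_sets borel_open open_UN)
    finally show ?thesis .
  qed
  have "card F \<le> nat \<lfloor>measure lebesgue S / l ^ CARD('n)\<rfloor>" if "F \<subseteq> centers W l" "finite F" for F
    using volume[OF that(2,1)] assms(1) by (simp add: le_nat_floor pos_le_divide_eq)
  then show "finite (centers W l)"
    using finite_if_finite_subsets_card_bdd by blast
  then show "real (card (centers W l)) * l ^ CARD('n) \<le> measure lebesgue S"
    by (rule volume) simp
qed

lemma finite_centers:
  assumes "0 < l"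
  shows "finite (centers W l)"
proof -
  obtain a b where "\<Union>W \<subseteq> cbox a b"
    using bounded_subset_cbox_symmetric[OF bounded_Union] by blast
  with assms show ?thesis
    by (intro card_centers_le(1)[of l "cbox a b"]) auto
qed

lemma countable_positive_cubes: "countable {(x, l). 0 < l \<and> cube x l \<in> W}"
proof -
  define J where "J = {(x, l). 0 < l \<and> cube x l \<in> W}"
  define Q :: "(real^'n) \<times> real \<Rightarrow> (real^'n) set" where "Q = (\<lambda>(x, l). interior (cube x l))"
  have nonempty: "Q j \<noteq> {}" if "j \<in> J" for j
    using that by (auto simp: J_def Q_def cube_eq_cbox interval_eq_empty_cart split: prod.splits)
  have disjoint: "Q j \<inter> Q j' = {}" if "j \<in> J" "j' \<in> J" "j \<noteq> j'" for j j'
  proof -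
    obtain x l x' l' where j: "j = (x, l)" "j' = (x', l')"
      by fastforce
    have "interior (cube x l) \<inter> cube x' l' = {}"
      using that cube_inject[of l x x' l'] by (intro interior_cube_Int_cube) (auto simp: J_def j)
    then show ?thesis
      using interior_subset[of "cube x' l'"] by (auto simp: j Q_def)
  qed
  have "inj_on Q J"
    using nonempty disjoint by (intro inj_onI) (metis inf.idem)
  moreover have "countable (Q ` J)"
  proof (rule countable_disjoint_open_subsets)
    show "open S" if "S \<in> Q ` J" for S
      using that by (auto simp: Q_def split: prod.splits)
    show "pairwise disjnt (Q ` J)"
      unfolding pairwise_def disjnt_def using disjoint by blast
  qed
  ultimately show ?thesis
    unfolding J_def using countable_image_inj_on by blast
qed

lemma beta_version_borel: "beta_version m \<beta> W \<in> sets borel"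
proof -
  have "apartment m \<beta> x l \<in> sets borel" for x l
    by (auto simp: apartment_def long_passage_eq_box cube_eq_cbox borel_closed)
  then have "(\<Union>(x, l)\<in>{(x, l). 0 < l \<and> cube x l \<in> W}. apartment m \<beta> x l) \<in> sets borel"
    using countable_positive_cubes by (intro sets.countable_UN') auto
  moreover have "beta_version m \<beta> W = (\<Union>(x, l)\<in>{(x, l). 0 < l \<and> cube x l \<in> W}. apartment m \<beta> x l)"
    by (auto simp: beta_version_def)
  ultimately show ?thesis
    by simp
qed

end

section \<open>The test function of a layer\<close>

definition layer_fun :: "'n \<Rightarrow> real \<Rightarrow> (real^'n::finite) set set \<Rightarrow> real \<Rightarrow> real^'n \<Rightarrow> real"
  where "layer_fun m \<beta> W l y = (\<Sum>x\<in>centers W l. chamber_fun m \<beta> x l y)"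

definition layer_grad :: "'n \<Rightarrow> real \<Rightarrow> (real^'n::finite) set set \<Rightarrow> real \<Rightarrow> real^'n \<Rightarrow> real^'n"
  where "layer_grad m \<beta> W l y = (\<Sum>x\<in>centers W l. chamber_grad m \<beta> x l y)"

lemma layer_fun_borel_measurable:
  assumes "0 < l"
  shows "layer_fun m \<beta> W l \<in> borel_measurable borel"
  unfolding layer_fun_def[abs_def] using assms
  by (intro borel_measurable_sum chamber_fun_borel_measurable)

lemma layer_grad_borel_measurable: "layer_grad m \<beta> W l \<in> borel_measurable borel"
  unfolding layer_grad_def[abs_def] by (intro borel_measurable_sum chamber_grad_borel_measurable)

lemma abs_layer_fun_le: "\<bar>layer_fun m \<beta> W l y\<bar> \<le> real (card (centers W l))"
proof -
  have "layer_fun m \<beta> W l y \<le> real (card (centers W l)) * 1"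
    unfolding layer_fun_def by (intro sum_bounded_above chamber_fun_bounds)
  moreover have "0 \<le> layer_fun m \<beta> W l y"
    unfolding layer_fun_def by (intro sum_nonneg chamber_fun_bounds)
  ultimately show ?thesis
    by simp
qed

locale apartment_packing = cube_packing W for W :: "(real^'n::finite) set set" +
  fixes \<beta> :: real
  assumes width_le: "0 < l \<Longrightarrow> cube x l \<in> W \<Longrightarrow> passage_width \<beta> l \<le> l / 8"
begin

lemma beta_version_subset_Union: "beta_version m \<beta> W \<subseteq> \<Union>W"
  using apartment_subset_cube width_le by (fastforce simp: beta_version_def)

lemma beta_version_lmeasurable: "beta_version m \<beta> W \<in> lmeasurable"
  using bounded_subset[OF bounded_Union beta_version_subset_Union] beta_version_borel
  by (intro bounded_set_imp_lmeasurable) (auto simp: sets_completionI_sets)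

context
  fixes l :: real and m :: 'n
  assumes l: "0 < l"
begin

lemma width_centers_le: "x \<in> centers W l \<Longrightarrow> passage_width \<beta> l \<le> l / 8"
  using width_le l by (simp add: centers_def)

lemma apartment_subset_beta_version: "x \<in> centers W l \<Longrightarrow> apartment m \<beta> x l \<subseteq> beta_version m \<beta> W"
  using l by (auto simp: beta_version_def centers_def)

lemma beta_version_subset_chamber_Un_exterior:
  assumes x: "x \<in> centers W l"
  shows "beta_version m \<beta> W \<subseteq> chamber m \<beta> x l \<union> exterior m \<beta> x l"
proof
  note width = width_centers_le[OF x]
  fix y assume "y \<in> beta_version m \<beta> W"
  then obtain x' l' where Q: "0 < l'" "cube x' l' \<in> W" "y \<in> apartment m \<beta> x' l'"
    by (auto simp: beta_version_def)
  show "y \<in> chamber m \<beta> x l \<union> exterior m \<beta> x l"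
  proof (cases "cube x l = cube x' l'")
    case True
    then have "x' = x" "l' = l"
      using cube_inject[OF l True] by auto
    then show ?thesis
      using Q(3) apartment_subset_chamber_Un_exterior[OF l width] by blast
  next
    case False
    have "y \<in> cube x' l'"
      using Q apartment_subset_cube[OF Q(1) width_le[OF Q(1,2)]] by blast
    then have "y \<notin> interior (cube x l)"
      using interior_cube_Int_cube[OF _ Q(2) False Q(1)] x by (auto simp: centers_def)
    then show ?thesis
      using exterior_Un_interior_cube[OF l width] by blast
  qed
qed

lemma layer_fun_eq_chamber_fun:
  assumes x: "x \<in> centers W l" and y: "y \<in> interior (cube x l)"
  shows "layer_fun m \<beta> W l y = chamber_fun m \<beta> x l y"
proof -
  have "chamber_fun m \<beta> x' l y = 0" if "x' \<in> centers W l" "x' \<noteq> x" for x'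
  proof -
    have "y \<notin> interior (cube x' l)"
      using disjoint_family_on_interiors[OF l] that x y by (auto simp: disjoint_family_on_def)
    then show ?thesis
      using chamber_subset_interior_cube[OF l width_centers_le[OF that(1)]]
      by (auto simp: chamber_fun_def)
  qed
  then have "layer_fun m \<beta> W l y = (\<Sum>x'\<in>{x}. chamber_fun m \<beta> x' l y)"
    unfolding layer_fun_def using finite_centers[OF l] x by (intro sum.mono_neutral_right) auto
  then show ?thesis
    by simp
qed

lemma layer_fun_room:
  assumes "x \<in> centers W l" "y \<in> room x l"
  shows "layer_fun m \<beta> W l y = 1"
  using assms room_subset_interior_cube[OF l] chamber_fun_room[OF l]
  by (subst layer_fun_eq_chamber_fun[of x]) auto

lemma layer_fun_corner:
  assumes x: "x \<in> centers W l" and y: "y \<in> corner x l"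
  shows "layer_fun m \<beta> W l y = 0"
proof -
  have "y \<in> interior (cube x l)" "y \<in> exterior m \<beta> x l"
    using y corner_subset_interior_cube[OF l] corner_subset_exterior[OF l] by blast+
  then show ?thesis
    using x chamber_fun_exterior[OF l width_centers_le[OF x]]
    by (simp add: layer_fun_eq_chamber_fun)
qed

lemma norm_layer_grad:
  "norm (layer_grad m \<beta> W l y) =
    1 / passage_width \<beta> l * indicator (\<Union>x\<in>centers W l. passage m \<beta> x l) y"
proof -
  have "passage m \<beta> x l \<subseteq> interior (cube x l)" if "x \<in> centers W l" for x
    using passage_eq_chamber_Int_slab[OF l width_centers_le[OF that]]
      chamber_subset_interior_cube[OF l width_centers_le[OF that]] by blast
  then have "disjoint_family_on (\<lambda>x. passage m \<beta> x l) (centers W l)"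
    using disjoint_family_on_interiors[OF l] unfolding disjoint_family_on_def by blast
  then have "indicator (\<Union>x\<in>centers W l. passage m \<beta> x l) y =
      (\<Sum>x\<in>centers W l. indicator (passage m \<beta> x l) y :: real)"
    using finite_centers[OF l] by (intro indicator_UN_disjoint)
  then have "layer_grad m \<beta> W l y =
      (- indicator (\<Union>x\<in>centers W l. passage m \<beta> x l) y / passage_width \<beta> l) *\<^sub>R axis m 1"
    by (simp only: layer_grad_def chamber_grad_def scaleR_left.sum[symmetric]
        sum_divide_distrib[symmetric] sum_negf)
  then show ?thesis
    using passage_width_pos[OF l, of \<beta>] by (simp add: norm_axis_1)
qed

lemma weak_gradient_layer_fun:
  "weak_gradient (beta_version m \<beta> W) (layer_fun m \<beta> W l) (layer_grad m \<beta> W l)"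
proof (rule weak_gradient_locally_lipschitz)
  define N where "N = (\<Union>x\<in>centers W l.
    {y::real^'n. y $ m = x $ m + l / 8} \<union> {y. y $ m = x $ m + l / 8 + passage_width \<beta> l})"
  show "beta_version m \<beta> W \<in> sets lebesgue"
    using beta_version_lmeasurable by blast
  have "negligible {y::real^'n. y $ m = c}" for c
    using negligible_standard_hyperplane[of "axis m 1 :: real^'n" c] by (simp add: inner_axis)
  then show "negligible N"
    unfolding N_def using finite_centers[OF l] by (auto intro!: negligible_Union negligible_Un)
  show "locally_lipschitz_at (layer_fun m \<beta> W l) y" if "y \<in> beta_version m \<beta> W" for y
    unfolding layer_fun_def[abs_def] using that beta_version_subset_chamber_Un_exterior
    by (intro locally_lipschitz_at_sum chamber_fun_locally_lipschitz_at[OF l width_centers_le]) auto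
  show "(layer_fun m \<beta> W l has_derivative (\<lambda>h. layer_grad m \<beta> W l y \<bullet> h)) (at y)"
    if "y \<in> beta_version m \<beta> W - N" for y
    unfolding layer_fun_def[abs_def] layer_grad_def inner_sum_left
    using that beta_version_subset_chamber_Un_exterior
    by (intro has_derivative_sum chamber_fun_has_derivative[OF l width_centers_le])
      (auto simp: N_def)
qed

lemma sobolev_layer_fun:
  assumes "0 \<le> p"
  shows "sobolev_W1p p (beta_version m \<beta> W) (layer_fun m \<beta> W l) (layer_grad m \<beta> W l)"
  unfolding sobolev_W1p_def
proof (intro conjI weak_gradient_layer_fun)
  have "layer_fun m \<beta> W l \<in> borel_measurable (lebesgue_on (beta_version m \<beta> W))"
    by (intro measurable_restrict_space1 measurable_completion)
      (simp add: layer_fun_borel_measurable[OF l])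
  then show "in_Lp p (beta_version m \<beta> W) (layer_fun m \<beta> W l)"
    using abs_layer_fun_le assms by (intro in_Lp_bounded[OF beta_version_lmeasurable]) auto
  have "layer_grad m \<beta> W l \<in> borel_measurable (lebesgue_on (beta_version m \<beta> W))"
    by (intro measurable_restrict_space1 measurable_completion)
      (simp add: layer_grad_borel_measurable)
  moreover have "norm (layer_grad m \<beta> W l y) \<le> 1 / passage_width \<beta> l" for y
    using passage_width_pos[OF l, of \<beta>] by (simp add: norm_layer_grad indicator_def)
  ultimately show "in_Lp p (beta_version m \<beta> W) (layer_grad m \<beta> W l)"
    using assms by (intro in_Lp_bounded[OF beta_version_lmeasurable]) auto
qed

lemma Lp_norm_layer_grad_le:
  assumes "0 < p"
  shows "Lp_norm p (beta_version m \<beta> W) (layer_grad m \<beta> W l) \<le>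
    1 / passage_width \<beta> l *
      (real (card (centers W l)) * (2 * passage_width \<beta> l) ^ CARD('n)) powr (1 / p)"
proof -
  note h = passage_width_pos[OF l, of \<beta>]
  define U where "U = (\<Union>x\<in>centers W l. passage m \<beta> x l)"
  have "passage m \<beta> x l \<subseteq> beta_version m \<beta> W" if "x \<in> centers W l" for x
  proof -
    have "passage m \<beta> x l \<subseteq> long_passage m \<beta> x l"
      using width_centers_le[OF that] l by (auto simp: mem_passage_iff mem_long_passage_iff)
    then show ?thesis
      using apartment_subset_beta_version[OF that] by (auto simp: apartment_def)
  qed
  then have "U \<subseteq> beta_version m \<beta> W"
    by (auto simp: U_def)
  moreover have "U \<in> lmeasurable"
    unfolding U_def using finite_centers[OF l]
    by (intro fmeasurable.finite_UN) (auto simp: passage_eq_box)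
  ultimately have "Lp_norm p (beta_version m \<beta> W) (layer_grad m \<beta> W l) \<le>
      1 / passage_width \<beta> l * measure lebesgue U powr (1 / p)"
    using assms h beta_version_lmeasurable
    by (intro Lp_norm_le_on_subset) (auto simp: norm_layer_grad U_def)
  also have "\<dots> \<le> 1 / passage_width \<beta> l *
      (real (card (centers W l)) * (2 * passage_width \<beta> l) ^ CARD('n)) powr (1 / p)"
  proof (intro mult_left_mono powr_mono2)
    have "measure lebesgue U \<le> (\<Sum>x\<in>centers W l. measure lebesgue (passage m \<beta> x l))"
      unfolding U_def using finite_centers[OF l]
      by (intro measure_UNION_le) (auto simp: passage_eq_box)
    also have "\<dots> \<le> real (card (centers W l)) * (2 * passage_width \<beta> l) ^ CARD('n)"
      by (intro sum_bounded_above measure_passage_le l)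
    finally show "measure lebesgue U \<le> real (card (centers W l)) * (2 * passage_width \<beta> l) ^ CARD('n)" .
  qed (use assms h in auto)
  finally show ?thesis .
qed

lemma Lp_norm_layer_fun_ge:
  assumes "0 < q" and f: "in_Lp q (beta_version m \<beta> W) (\<lambda>y. layer_fun m \<beta> W l y - c)"
  shows "1 / 2 * (real (card (centers W l)) * (l / 4) ^ CARD('n)) powr (1 / q) \<le>
    Lp_norm q (beta_version m \<beta> W) (\<lambda>y. layer_fun m \<beta> W l y - c)"
proof -
  define A where "A = (\<Union>x\<in>centers W l. room x l)"
  define B where "B = (\<Union>x\<in>centers W l. corner x l)"
  have "A \<subseteq> beta_version m \<beta> W"
    unfolding A_def using apartment_subset_beta_version room_subset_apartment[OF l] by blast
  moreover have "corner x l \<subseteq> apartment m \<beta> x l" for x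
    using corner_subset_interior_cube[OF l, of x] corner_subset_exterior[OF l, of x m \<beta>]
      interior_subset[of "cube x l"] cube_Int_exterior_subset_apartment[of x l m \<beta>] by blast
  then have "B \<subseteq> beta_version m \<beta> W"
    unfolding B_def using apartment_subset_beta_version by blast
  moreover have rooms_lmeasurable: "room x l \<in> lmeasurable" "corner x l \<in> lmeasurable" for x :: "real^'n"
    by (simp_all add: room_eq_box corner_def)
  then have "A \<in> lmeasurable" "B \<in> lmeasurable"
    unfolding A_def B_def using finite_centers[OF l] by (auto intro: fmeasurable.finite_UN)
  moreover have "measure lebesgue A = real (card (centers W l)) * (l / 4) ^ CARD('n)"
    unfolding A_def using room_subset_interior_cube[OF l] rooms_lmeasurable measure_room[OF l]
    by (intro measure_UN_centers[OF l finite_centers[OF l]]) auto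
  moreover have "measure lebesgue B = real (card (centers W l)) * (l / 4) ^ CARD('n)"
    unfolding B_def using corner_subset_interior_cube[OF l] rooms_lmeasurable measure_room[OF l]
    by (intro measure_UN_centers[OF l finite_centers[OF l]]) (auto simp: corner_def)
  moreover have "layer_fun m \<beta> W l y = 1" if "y \<in> A" for y
    using that layer_fun_room by (auto simp: A_def)
  moreover have "layer_fun m \<beta> W l y = 0" if "y \<in> B" for y
    using that layer_fun_corner by (auto simp: B_def)
  ultimately have "\<bar>1 - 0\<bar> / 2 * (real (card (centers W l)) * (l / 4) ^ CARD('n)) powr (1 / q) \<le>
      Lp_norm q (beta_version m \<beta> W) (\<lambda>y. layer_fun m \<beta> W l y - c)"
    using assms l beta_version_lmeasurable
    by (intro Lp_norm_diff_const_ge_two_values[of q _ "layer_fun m \<beta> W l" c A 1 B 0]) auto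
  then show ?thesis
    by simp
qed

end

end

lemma whitney_imp_apartment_packing:
  assumes W: "whitney G W" and G: "bounded G" "diameter G \<le> 8" and \<beta>: "0 < \<beta>" "\<beta> \<le> 1"
  shows "apartment_packing W \<beta>"
proof
  show "pairwise (\<lambda>Q Q'. interior Q \<inter> interior Q' = {}) W" "bounded (\<Union>W)"
    using W G(1) by (auto simp: whitney_def)
  fix l x assume l: "0 < l" and "cube x l \<in> W"
  then have "cube x l \<subseteq> G"
    using W by (auto simp: whitney_def)
  then have "l \<le> diameter G"
    using l G(1) by (intro cube_side_le_diameter) auto
  with G(2) l \<beta> show "passage_width \<beta> l \<le> l / 8"
    by (intro passage_width_le) auto
qed

section \<open>Comparison of exponents\<close>

lemma layer_estimate_imp_powr_diff_le:
  fixes N l c q p \<beta> :: real and n :: nat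
  assumes "0 \<le> N" "0 < l" "0 < p" "0 < q" "0 \<le> c"
    and estimate: "1 / 2 * (N * (l / 4) ^ n) powr (1 / q) \<le>
      c * (1 / passage_width \<beta> l * (N * (2 * passage_width \<beta> l) ^ n) powr (1 / p))"
  shows "N powr (1 / q - 1 / p) \<le>
    c * 2 * 4 powr (n / q) * 2 powr (n / p) * 8 powr (- ((n / p - 1) / \<beta>)) *
      l powr ((n / p - 1) / \<beta> - n / q)"
proof (cases "N = 0")
  case True
  with \<open>0 \<le> c\<close> show ?thesis
    by simp
next
  case False
  with \<open>0 \<le> N\<close> have "0 < N"
    by simp
  define h where "h = passage_width \<beta> l"
  have "0 < h"
    unfolding h_def using \<open>0 < l\<close> by (rule passage_width_pos)
  define s where "s = (n / p - 1) / \<beta>"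
  have rooms: "(N * (l / 4) ^ n) powr (1 / q) = N powr (1 / q) * l powr (n / q) / 4 powr (n / q)"
    using \<open>0 < N\<close> \<open>0 < l\<close> by (simp add: powr_mult powr_powr powr_divide powr_realpow[symmetric])
  have "1 / h * (N * (2 * h) ^ n) powr (1 / p) = N powr (1 / p) * 2 powr (n / p) * h powr (n / p - 1)"
    using \<open>0 < N\<close> \<open>0 < h\<close> by (simp add: powr_mult powr_powr powr_diff powr_realpow[symmetric])
  then have passages: "1 / h * (N * (2 * h) ^ n) powr (1 / p) =
      N powr (1 / p) * 2 powr (n / p) * (l powr s * 8 powr (- s))"
    by (simp only: h_def passage_width_powr[OF \<open>0 < l\<close>] s_def)
  have "N powr (1 / q - 1 / p) * l powr (n / q) =
      2 * 4 powr (n / q) * (1 / 2 * (N * (l / 4) ^ n) powr (1 / q)) / N powr (1 / p)"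
    unfolding rooms by (simp add: powr_diff)
  also have "\<dots> \<le> 2 * 4 powr (n / q) *
      (c * (N powr (1 / p) * 2 powr (n / p) * (l powr s * 8 powr (- s)))) / N powr (1 / p)"
    using estimate unfolding h_def[symmetric] passages
    by (intro divide_right_mono mult_left_mono) auto
  also have "\<dots> = c * 2 * 4 powr (n / q) * 2 powr (n / p) * 8 powr (- s) * l powr s"
    using \<open>0 < N\<close> by simp
  finally show ?thesis
    using \<open>0 < l\<close> by (simp add: s_def[symmetric] powr_diff pos_le_divide_eq)
qed

lemma (in apartment_packing) poincare_imp_card_centers_powr_le:
  assumes poincare: "poincare q p (beta_version m \<beta> W)" and "0 < q" "0 < p"
  obtains K where "\<forall>l>0. real (card (centers W l)) powr (1 / q - 1 / p) \<le>
    K * l powr ((CARD('n) / p - 1) / \<beta> - CARD('n) / q)"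
proof -
  let ?D = "beta_version m \<beta> W" and ?N = "\<lambda>l. real (card (centers W l))"
  obtain c where c: "0 \<le> c" "\<forall>u g. sobolev_W1p p ?D u g \<longrightarrow>
      (\<exists>a. in_Lp q ?D (\<lambda>x. u x - a) \<and> Lp_norm q ?D (\<lambda>x. u x - a) \<le> c * Lp_norm p ?D g)"
    using poincare by (rule poincare_imp_Lp_norm_diff_const_le)
  define K where "K = c * 2 * 4 powr (CARD('n) / q) * 2 powr (CARD('n) / p) *
    8 powr (- ((CARD('n) / p - 1) / \<beta>))"
  have "?N l powr (1 / q - 1 / p) \<le> K * l powr ((CARD('n) / p - 1) / \<beta> - CARD('n) / q)"
    if l: "0 < l" for l
  proof -
    let ?u = "layer_fun m \<beta> W l" and ?g = "layer_grad m \<beta> W l" and ?h = "passage_width \<beta> l"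
    have "sobolev_W1p p ?D ?u ?g"
      using \<open>0 < p\<close> by (intro sobolev_layer_fun[OF l]) simp
    with c(2) obtain a where u: "in_Lp q ?D (\<lambda>x. ?u x - a)"
      and bound: "Lp_norm q ?D (\<lambda>x. ?u x - a) \<le> c * Lp_norm p ?D ?g"
      by blast
    have "1 / 2 * (?N l * (l / 4) ^ CARD('n)) powr (1 / q) \<le> Lp_norm q ?D (\<lambda>x. ?u x - a)"
      by (rule Lp_norm_layer_fun_ge[OF l \<open>0 < q\<close> u])
    also note bound
    also have "c * Lp_norm p ?D ?g \<le> c * (1 / ?h * (?N l * (2 * ?h) ^ CARD('n)) powr (1 / p))"
      by (intro mult_left_mono Lp_norm_layer_grad_le[OF l \<open>0 < p\<close>] c(1))
    finally show ?thesis
      unfolding K_def using l \<open>0 < p\<close> \<open>0 < q\<close> c(1)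
      by (intro layer_estimate_imp_powr_diff_le) simp_all
  qed
  then show ?thesis
    using that by blast
qed

lemma limsup_posE:
  fixes f :: "nat \<Rightarrow> real"
  assumes "limsup (\<lambda>k. ereal (f k)) > 0"
  obtains e where "0 < e" "\<exists>\<^sub>F k in sequentially. e < f k"
proof -
  obtain e where e: "0 < e" "ereal e < limsup (\<lambda>k. ereal (f k))"
    using ereal_dense2[OF assms] by auto
  have "\<not> (\<forall>\<^sub>F k in sequentially. ereal (f k) \<le> ereal e)"
  proof
    assume "\<forall>\<^sub>F k in sequentially. ereal (f k) \<le> ereal e"
    then have "limsup (\<lambda>k. ereal (f k)) \<le> ereal e"
      by (rule Limsup_bounded)
    with e(2) show False
      by simp
  qed
  then have "\<exists>\<^sub>F k in sequentially. e < f k"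
    by (simp add: frequently_def not_less)
  with e(1) that show ?thesis
    by simp
qed

lemma powr_half_power_tendsto_0:
  fixes K \<delta> :: real
  assumes "0 < \<delta>"
  shows "(\<lambda>k. K * (1 / 2 ^ k) powr \<delta>) \<longlonglongrightarrow> 0"
proof -
  have "(\<lambda>k. 1 / 2 ^ k :: real) \<longlonglongrightarrow> 0"
    using LIMSEQ_realpow_zero[of "1 / 2 :: real"] by (simp add: power_one_over)
  then have "(\<lambda>k. (1 / 2 ^ k :: real) powr \<delta>) \<longlonglongrightarrow> 0"
    using assms by (intro tendsto_zero_powrI[where b = \<delta>]) auto
  then show ?thesis
    by (rule tendsto_mult_right_zero)
qed

lemma growth_exponent_nonpos:
  fixes N :: "nat \<Rightarrow> real"
  assumes limsup: "limsup (\<lambda>k. ereal (2 powr (- lam * real k) * N k)) > 0"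
    and "0 < a" and N: "\<And>k. N k powr a \<le> K * (1 / 2 ^ k) powr s"
  shows "lam * a + s \<le> 0"
proof (rule ccontr)
  assume "\<not> ?thesis"
  then have "(\<lambda>k. K * (1 / 2 ^ k) powr (lam * a + s)) \<longlonglongrightarrow> 0"
    by (intro powr_half_power_tendsto_0) simp
  moreover obtain e where e: "0 < e" "\<exists>\<^sub>F k in sequentially. e < 2 powr (- lam * real k) * N k"
    using limsup by (rule limsup_posE)
  moreover have "0 < e powr a"
    using e(1) by simp
  ultimately have "\<forall>\<^sub>F k in sequentially. K * (1 / 2 ^ k) powr (lam * a + s) < e powr a"
    by (intro order_tendstoD(2))
  then obtain k where k: "e < 2 powr (- lam * real k) * N k"
      "K * (1 / 2 ^ k) powr (lam * a + s) < e powr a"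
    using frequently_ex[OF frequently_eventually_frequently[OF e(2)]] by auto
  define l :: real where "l = 1 / 2 ^ k"
  have "2 powr (- lam * real k) = l powr lam"
    by (simp add: l_def powr_divide powr_realpow[symmetric] powr_powr powr_minus_divide mult.commute)
  with k(1) have large: "e < l powr lam * N k"
    by (simp only:)
  with e(1) have "0 < l powr lam * N k"
    by linarith
  then have "0 < N k"
    by (simp add: zero_less_mult_iff)
  have "e powr a < (l powr lam * N k) powr a"
    using large e(1) \<open>0 < a\<close> by (intro powr_less_mono2) auto
  also have "\<dots> = l powr (lam * a) * N k powr a"
    using \<open>0 < N k\<close> by (simp add: powr_mult powr_powr)
  also have "\<dots> \<le> l powr (lam * a) * (K * l powr s)"
    using N[of k] by (intro mult_left_mono) (auto simp: l_def)
  also have "\<dots> = K * l powr (lam * a + s)"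
    by (simp add: powr_add)
  finally show False
    using k(2) by (simp add: l_def)
qed

text \<open>The hypothesis on \<open>p\<close> forces \<open>b < 1\<close>, hence \<open>\<beta> < b\<close>; the bound on \<open>p\<close> is strictly decreasing
  in \<open>b\<close>.\<close>

lemma poincare_exponent_pos:
  fixes n lam b \<beta> p q :: real
  assumes "0 < n" "0 \<le> lam" "lam \<le> n" "0 < q" "q < p" "0 < \<beta>" and b: "b = 2 * \<beta> / (1 + \<beta>)"
    and p: "p \<le> q * (n - lam * b) / (q + b * (n - lam))"
  shows "0 < lam * (1 / q - 1 / p) + ((n / p - 1) / \<beta> - n / q)"
proof -
  define A where "A = lam * q + p * (n - lam)"
  have "0 < b"
    using assms by simp
  then have "0 < q + b * (n - lam)"
    using assms by (simp add: add_pos_nonneg)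
  with p have "p * (q + b * (n - lam)) \<le> q * (n - lam * b)"
    by (simp add: pos_le_divide_eq)
  then have upper: "b * A \<le> q * (n - p)"
    by (simp add: A_def algebra_simps)
  have "q * (n - lam) \<le> p * (n - lam)"
    using assms by (intro mult_right_mono) auto
  then have "q * n \<le> A"
    by (simp add: A_def algebra_simps)
  moreover have "0 < q * n" "0 < q * p"
    using assms by auto
  ultimately have "0 < A" "b * A < 1 * A"
    using upper unfolding right_diff_distrib by linarith+
  then have "b < 1"
    by (simp only: mult_less_cancel_right_pos)
  then have "\<beta> < 1"
    using assms by (simp add: b)
  then have "\<beta> * (1 + \<beta>) < \<beta> * 2"
    using assms by (intro mult_strict_left_mono) auto
  then have "\<beta> < b"
    unfolding b using assms by (simp add: pos_less_divide_eq mult.commute)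
  then have "\<beta> * A < q * (n - p)"
    using mult_strict_right_mono[OF \<open>\<beta> < b\<close> \<open>0 < A\<close>] upper by linarith
  moreover have "lam * (1 / q - 1 / p) + ((n / p - 1) / \<beta> - n / q) =
      (q * (n - p) - \<beta> * A) / (p * q * \<beta>)"
    using assms by (simp add: A_def field_simps)
  ultimately show ?thesis
    using assms by simp
qed

lemma (in cube_packing) growth_exponent_le_dimension:
  assumes "limsup (\<lambda>k. ereal (2 powr (- lam * real k) * real (card (whitney_layer W k)))) > 0"
  shows "lam \<le> CARD('n)"
proof -
  obtain a b where S: "\<Union>W \<subseteq> cbox a b"
    using bounded_subset_cbox_symmetric[OF bounded_Union] by blast
  have "real (card (whitney_layer W k)) powr 1 \<le>
      measure lebesgue (cbox a b) * (1 / 2 ^ k) powr (- real CARD('n))" for k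
    using card_centers_le(2)[OF _ _ S, of "1 / 2 ^ k"]
    by (simp add: card_whitney_layer powr_minus powr_realpow power_one_over divide_simps)
  from growth_exponent_nonpos[OF assms _ this] show ?thesis
    by simp
qed

theorem theorem4p7:
  fixes G :: "(real^'n) set" and W :: "(real^'n) set set" and m :: "'n::finite"
    and p q \<beta> b lam :: real
  assumes "2 \<le> CARD('n)"
    and "john_domain G"
    and "diameter G \<le> 4"
    and "whitney G W"
    and "lam = enn2real (upper_minkowski_dim (frontier G))"
    and "limsup (\<lambda>k. ereal (2 powr (- lam * real k) * real (card (whitney_layer W k)))) > 0"
    and "1 \<le> q" and "q < p"
    and "0 < \<beta>" and "\<beta> \<le> 1"
    and "b = 2 * \<beta> / (1 + \<beta>)"
    and "p \<le> q * (real CARD('n) - lam * b) / (q + b * (real CARD('n) - lam))"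
  shows "\<not> poincare q p (beta_version m \<beta> W)"
proof
  assume poincare: "poincare q p (beta_version m \<beta> W)"
  interpret apartment_packing W \<beta>
    using assms(2-4,9,10) by (intro whitney_imp_apartment_packing) (auto simp: john_domain_def)
  obtain K where "\<forall>l>0. real (card (centers W l)) powr (1 / q - 1 / p) \<le>
      K * l powr ((CARD('n) / p - 1) / \<beta> - CARD('n) / q)"
    using poincare_imp_card_centers_powr_le[OF poincare] assms(7,8) by auto
  then have "real (card (whitney_layer W k)) powr (1 / q - 1 / p) \<le>
      K * (1 / 2 ^ k) powr ((CARD('n) / p - 1) / \<beta> - CARD('n) / q)" for k
    by (simp add: card_whitney_layer)
  moreover have "0 < 1 / q - 1 / p"
    using assms(7,8) by (simp add: frac_less2)
  ultimately have "lam * (1 / q - 1 / p) + ((CARD('n) / p - 1) / \<beta> - CARD('n) / q) \<le> 0"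
    by (intro growth_exponent_nonpos[OF assms(6)])
  moreover have "0 \<le> lam" "lam \<le> CARD('n)"
    using assms(5) growth_exponent_le_dimension[OF assms(6)] by simp_all
  then have "0 < lam * (1 / q - 1 / p) + ((CARD('n) / p - 1) / \<beta> - CARD('n) / q)"
    using assms(7-9,11,12) by (intro poincare_exponent_pos[of _ _ _ _ _ b]) auto
  ultimately show False
    by linarith
qed

end
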